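(* Fix an integer $m>1$. For every $d$ there is an integer $N(d)>0$ such that, with $n=N(d)$, every $\{0,1\}$-polytope $P\subseteq\mathbb{R}^d$ (i.e. every polytope all of whose vertices have all components in $\{0,1\}$) is affinely isomorphic to a face of $2TSP(n)$ and to a face of $RTSP(m,n)$.
   Context: $STSP(n)$ is the symmetric traveling salesman polytope: the convex hull of the adjacency matrices of all Hamiltonian cycles in the complete graph on $n$ vertices. Choose coordinates on its affine span with origin at the average of its vertices, so that it becomes a convex body (full-dimensional compact convex set) with $0$ in its interior in a real vector space; this body is also denoted $STSP(n)$. For convex bodies $P_i\subseteq E_i$ containing the origin in their interior: $P_1\otimes P_2:=\mathrm{Conv}\{(p_1,p_2,p_1\otimes p_2):p_i\in P_i\}\subseteq E_1\times E_2\times(E_1\otimes E_2)$, and $\mathrm{Sym}^m(P_1):=\mathrm{Conv}\{(e_1(p_1,\dots,p_m),\dots,e_m(p_1,\dots,p_m)):p_i\in P_1\}\subseteq\prod_{j=1}^m\mathrm{Sym}^j(E_1)$, where $e_j$ is the $j$-th elementary symmetric polynomial (products taken in the symmetric algebra of $E_1$). Define $2TSP(n):=STSP(n)\otimes STSP(n)$ and $RTSP(m,n):=\mathrm{Sym}^m(STSP(n))$. *)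

theory Defs
  imports "HOL-Analysis.Analysis" "HOL-Analysis.Finite_Function_Topology"
begin

text \<open>
  Since \<open>n\<close>, \<open>d\<close> and \<open>m\<close> are quantified natural numbers, all vectors are finitely supported
  functions \<open>'a \<Rightarrow>\<^sub>0 real\<close>, a real vector space with basis \<open>'a\<close>. A convex body in \<open>E\<close>
  is represented by its image under an inclusion of \<open>E\<close> as a linear subspace of such a space.
  In these coordinates, \<open>('a \<Rightarrow>\<^sub>0 real) \<otimes> ('b \<Rightarrow>\<^sub>0 real)\<close> is \<open>'a \<times> 'b \<Rightarrow>\<^sub>0 real\<close>, and the symmetric
  algebra of \<open>'a \<Rightarrow>\<^sub>0 real\<close> is the polynomial ring \<open>('a \<Rightarrow>\<^sub>0 nat) \<Rightarrow>\<^sub>0 real\<close>. For subspaces \<open>E\<^sub>1\<close>, \<open>E\<^sub>2\<close>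
  the natural maps from \<open>E\<^sub>1 \<otimes> E\<^sub>2\<close> and from the symmetric algebra of \<open>E\<^sub>1\<close> into these spaces
  are injective.
\<close>


text \<open>Hamiltonian cycles of the complete graph on \<open>{..<n}\<close>, given by their edge sets.
  There are none for \<open>n < 3\<close>.\<close>

definition hamiltonian_cycle :: "nat \<Rightarrow> nat set set \<Rightarrow> bool" where
  "hamiltonian_cycle n C \<longleftrightarrow> n \<ge> 3 \<and>
     (\<exists>xs. distinct xs \<and> set xs = {..<n} \<and> C = {{xs ! i, xs ! (Suc i mod n)} |i. i < n})"

definition adjacency_matrix :: "nat \<Rightarrow> nat set set \<Rightarrow> (nat \<times> nat \<Rightarrow>\<^sub>0 real)" where
  "adjacency_matrix n C =
     (\<Sum>(i, j) \<in> {..<n} \<times> {..<n}. Poly_Mapping.single (i, j) (if {i, j} \<in> C then 1 else 0))"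

definition stsp_polytope :: "nat \<Rightarrow> (nat \<times> nat \<Rightarrow>\<^sub>0 real) set" where
  "stsp_polytope n = convex hull {adjacency_matrix n C |C. hamiltonian_cycle n C}"

definition vertices :: "'a::real_vector set \<Rightarrow> 'a set" where
  "vertices P = {v. v extreme_point_of P}"

text \<open>Translating the average of the vertices to the origin turns the affine span into a
  linear subspace, in which the translate is full-dimensional with \<open>0\<close> in its interior.\<close>

definition STSP :: "nat \<Rightarrow> (nat \<times> nat \<Rightarrow>\<^sub>0 real) set" where
  "STSP n =
     (let V = vertices (stsp_polytope n); c = (1 / real (card V)) *\<^sub>R (\<Sum>v\<in>V. v)
      in (\<lambda>x. x - c) ` stsp_polytope n)"


definition tensor_vec :: "('a \<Rightarrow>\<^sub>0 real) \<Rightarrow> ('b \<Rightarrow>\<^sub>0 real) \<Rightarrow> ('a \<times> 'b \<Rightarrow>\<^sub>0 real)" where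
  "tensor_vec p q =
     (\<Sum>(a, b) \<in> Poly_Mapping.keys p \<times> Poly_Mapping.keys q.
        Poly_Mapping.single (a, b) (Poly_Mapping.lookup p a * Poly_Mapping.lookup q b))"

definition tensor_body ::
    "('a \<Rightarrow>\<^sub>0 real) set \<Rightarrow> ('b \<Rightarrow>\<^sub>0 real) set
      \<Rightarrow> (('a \<Rightarrow>\<^sub>0 real) \<times> ('b \<Rightarrow>\<^sub>0 real) \<times> ('a \<times> 'b \<Rightarrow>\<^sub>0 real)) set" where
  "tensor_body P Q = convex hull {(p, q, tensor_vec p q) |p q. p \<in> P \<and> q \<in> Q}"


text \<open>The inclusion of a vector space as the degree-1 part of its symmetric algebra:
  \<open>p\<close> becomes the linear form \<open>\<Sum>\<^sub>a p\<^sub>a X\<^sub>a\<close>.\<close>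

definition sym_of_vec :: "('a \<Rightarrow>\<^sub>0 real) \<Rightarrow> (('a \<Rightarrow>\<^sub>0 nat) \<Rightarrow>\<^sub>0 real)" where
  "sym_of_vec p =
     (\<Sum>a \<in> Poly_Mapping.keys p.
        Poly_Mapping.single (Poly_Mapping.single a 1) (Poly_Mapping.lookup p a))"

definition elem_sym :: "nat \<Rightarrow> nat \<Rightarrow> (nat \<Rightarrow> 'r::comm_ring_1) \<Rightarrow> 'r" where
  "elem_sym m j x = (\<Sum>J | J \<subseteq> {1..m} \<and> card J = j. \<Prod>i\<in>J. x i)"

text \<open>The tuple \<open>(e\<^sub>1, \<dots>, e\<^sub>m)\<close> is encoded as a finitely supported function of its index.\<close>

definition sym_body ::
    "nat \<Rightarrow> ('a \<Rightarrow>\<^sub>0 real) set \<Rightarrow> (nat \<Rightarrow>\<^sub>0 (('a \<Rightarrow>\<^sub>0 nat) \<Rightarrow>\<^sub>0 real)) set" where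
  "sym_body m P =
     convex hull {(\<Sum>j = 1..m. Poly_Mapping.single j (elem_sym m j (\<lambda>i. sym_of_vec (p i)))) |p.
                    \<forall>i\<in>{1..m}. p i \<in> P}"


definition TSP2 where "TSP2 n = tensor_body (STSP n) (STSP n)"

definition RTSP where "RTSP m n = sym_body m (STSP n)"


text \<open>\<open>\<real>\<^sup>d\<close> consists of the vectors supported on \<open>{..<d}\<close>.\<close>

definition zero_one_polytope :: "nat \<Rightarrow> (nat \<Rightarrow>\<^sub>0 real) set \<Rightarrow> bool" where
  "zero_one_polytope d P \<longleftrightarrow>
     polytope P \<and> (\<forall>x\<in>P. Poly_Mapping.keys x \<subseteq> {..<d}) \<and>
     (\<forall>v\<in>vertices P. \<forall>i<d. Poly_Mapping.lookup v i \<in> {0, 1})"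

definition affine_map_on :: "'a::real_vector set \<Rightarrow> ('a \<Rightarrow> 'b::real_vector) \<Rightarrow> bool" where
  "affine_map_on A f \<longleftrightarrow>
     (\<forall>x\<in>A. \<forall>y\<in>A. \<forall>u v. u + v = 1 \<longrightarrow> f (u *\<^sub>R x + v *\<^sub>R y) = u *\<^sub>R f x + v *\<^sub>R f y)"

definition affinely_isomorphic :: "'a::real_vector set \<Rightarrow> 'b::real_vector set \<Rightarrow> bool" where
  "affinely_isomorphic P Q \<longleftrightarrow>
     (\<exists>f. affine_map_on (affine hull P) f \<and>
          bij_betw f (affine hull P) (affine hull Q) \<and> f ` P = Q)"

end

theory Submission
  imports Defs
begin

text \<open>
  Everything rests on one construction: for every family \<open>\<G>\<close> of subsets of \<open>{..<D}\<close> with nonempty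
  complement there is a digraph, of a size depending on \<open>D\<close> only, whose Hamiltonian cycles
  correspond to the members of \<open>\<G>\<close>, and in which the arcs used are affine functions of the 0-1
  vector of the member.

  The digraph comes from permutations. The nodes form \<open>D\<close> columns. Column \<open>i\<close> has one node of a
  main row and, for each excluded set \<open>T r\<close>, one node in each of two further rows. Without any
  interaction the main row and the first row of each pair are traversed in increasing cyclic
  order and the second row of the pair in decreasing cyclic order. The bit of column \<open>i\<close> adds a
  permutation of that column: a cycle that starts in the main row and runs through the pairs of
  rows of all \<open>r\<close> for which the bit disagrees with \<open>T r\<close>. If the chosen set equals some \<open>T r\<close>,
  no column links the pair of \<open>r\<close> to anything, and its rows are separate cycles. Otherwise each pair
  is linked in at least one column; the opposite orders in the two rows make an excursion through
  a pair return to the column where it began, and so all of the rows merge into one cycle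
  (\<open>cyclic_perm_succ_at\<close>). Conversely the two out-neighbours allowed at the nodes of a column
  form a single alternating cycle, so that a bijective choice of out-neighbours takes the same
  bit throughout the column (\<open>bijective_selection_is_uniform\<close>).

  Splitting each node into an in-vertex and an out-vertex joined by an edge turns directed cycles
  into undirected ones. Counting joining edges positively and foreign edges negatively gives a
  linear functional that is maximal exactly at the cycles wanted. Hence the convex hull of any set
  of 0-1 vectors is affinely isomorphic to a face of the symmetric travelling salesman polytope
  (\<open>maximal_tour_matrices\<close>).

  For the two derived bodies this is applied not to \<open>P\<close> but to a pyramid over \<open>P\<close>, which has one
  more coordinate. It yields a face \<open>F \<cong> P\<close>, an apex \<open>w\<close> and an edge whose coordinate \<open>h\<close> is
  between 0 and 1, is 1 on \<open>F\<close> and 0 at \<open>w\<close>. In \<open>K \<otimes> K\<close> a sum of two functionals cuts out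
  \<open>F \<otimes> {w}\<close> (\<open>tensor_body_face\<close>). In \<open>Sym\<^sup>m K\<close> put \<open>y\<^sub>i = h (p\<^sub>i)\<close>; the function
  \<open>(\<Sum> y\<^sub>i - 1)\<^sup>2 + \<Sum> y\<^sub>i (1 - y\<^sub>i)\<close> contains no squares of single variables, so that it is linear in
  \<open>e\<^sub>1\<close> and \<open>e\<^sub>2\<close>, and it vanishes exactly if one \<open>y\<^sub>i\<close> is 1 and the others are 0. This cuts
  out the tuples with one entry in \<open>F\<close> and all others equal to \<open>w\<close> (\<open>sym_body_face\<close>). Both
  of these faces are injective affine images of \<open>F\<close>.
\<close>

section \<open>Affine maps and faces cut out by a linear functional\<close>

lemma affine_map_on_comp:
  assumes "affine_map_on UNIV f" "affine_map_on UNIV g"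
  shows "affine_map_on UNIV (\<lambda>x. g (f x))"
  using assms by (simp add: affine_map_on_def)

lemma affine_map_on_translation:
  fixes a :: "'a::real_vector"
  shows "affine_map_on UNIV (\<lambda>x. x + a)"
  unfolding affine_map_on_def
proof (intro ballI allI impI)
  fix x y :: 'a and u v :: real
  assume "u + v = 1"
  then have "u *\<^sub>R a + v *\<^sub>R a = a" by (simp flip: scaleR_left_distrib)
  then show "u *\<^sub>R x + v *\<^sub>R y + a = u *\<^sub>R (x + a) + v *\<^sub>R (y + a)"
    by (simp add: algebra_simps)
qed

lemma affine_map_on_linear:
  assumes "linear f"
  shows "affine_map_on UNIV f"
  using assms by (simp add: affine_map_on_def linear_add linear_scale)

lemma affine_map_image_convex_hull:
  assumes "affine_map_on UNIV f"
  shows "f ` (convex hull S) = convex hull (f ` S)"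
proof
  have "convex (f -` (convex hull (f ` S)))"
    using assms convexD[OF convex_convex_hull, of _ "f ` S"]
    by (intro convexI) (simp add: affine_map_on_def)
  then have "convex hull S \<subseteq> f -` (convex hull (f ` S))"
    by (intro hull_minimal) (auto intro: hull_inc)
  then show "f ` (convex hull S) \<subseteq> convex hull (f ` S)" by auto
  have "convex (f ` (convex hull S))"
  proof (rule convexI)
    fix x y and u v :: real
    assume "x \<in> f ` (convex hull S)" "y \<in> f ` (convex hull S)" and uv: "0 \<le> u" "0 \<le> v" "u + v = 1"
    then obtain p q where pq: "p \<in> convex hull S" "q \<in> convex hull S" "x = f p" "y = f q" by auto
    have "u *\<^sub>R x + v *\<^sub>R y = f (u *\<^sub>R p + v *\<^sub>R q)"
      using assms uv pq by (simp add: affine_map_on_def)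
    moreover have "u *\<^sub>R p + v *\<^sub>R q \<in> convex hull S"
      using pq uv by (simp add: convexD[OF convex_convex_hull])
    ultimately show "u *\<^sub>R x + v *\<^sub>R y \<in> f ` (convex hull S)" by blast
  qed
  then show "convex hull (f ` S) \<subseteq> f ` (convex hull S)"
    by (intro hull_minimal) (auto intro: hull_inc)
qed

lemma affine_map_image_affine_hull:
  assumes "affine_map_on UNIV f"
  shows "f ` (affine hull S) = affine hull (f ` S)"
proof
  have "affine (f -` (affine hull (f ` S)))"
    using assms
    by (auto simp: affine_def[of "f -` _"] affine_map_on_def intro!: mem_affine[OF affine_affine_hull])
  then have "affine hull S \<subseteq> f -` (affine hull (f ` S))"
    by (intro hull_minimal) (auto intro: hull_inc)
  then show "f ` (affine hull S) \<subseteq> affine hull (f ` S)" by auto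
  have "affine (f ` (affine hull S))"
    unfolding affine_def[of "f ` _"]
  proof (intro ballI allI impI)
    fix x y and u v :: real
    assume "x \<in> f ` (affine hull S)" "y \<in> f ` (affine hull S)" and uv: "u + v = 1"
    then obtain p q where pq: "p \<in> affine hull S" "q \<in> affine hull S" "x = f p" "y = f q" by auto
    have "u *\<^sub>R x + v *\<^sub>R y = f (u *\<^sub>R p + v *\<^sub>R q)"
      using assms uv pq by (simp add: affine_map_on_def)
    moreover have "u *\<^sub>R p + v *\<^sub>R q \<in> affine hull S"
      using pq uv by (intro mem_affine[OF affine_affine_hull])
    ultimately show "u *\<^sub>R x + v *\<^sub>R y \<in> f ` (affine hull S)" by blast
  qed
  then show "affine hull (f ` S) \<subseteq> f ` (affine hull S)"
    by (intro hull_minimal) (auto intro: hull_inc)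
qed

lemma affinely_isomorphic_image:
  assumes f: "affine_map_on UNIV f" and "affine A" "P \<subseteq> A" "inj_on f A"
  shows "affinely_isomorphic P (f ` P)"
  unfolding affinely_isomorphic_def
proof (intro exI conjI)
  show "affine_map_on (affine hull P) f"
    using f by (simp add: affine_map_on_def)
  have "affine hull P \<subseteq> A" using assms by (simp add: hull_minimal)
  then show "bij_betw f (affine hull P) (affine hull (f ` P))"
    using assms affine_map_image_affine_hull[OF f] by (metis bij_betw_def inj_on_subset)
qed simp

lemma maximal_level_face_of:
  fixes L :: "'a::real_vector \<Rightarrow> real"
  assumes "linear L" "convex S" "\<And>x. x \<in> S \<Longrightarrow> L x \<le> b"
  shows "{x \<in> S. L x = b} face_of S"
  unfolding face_of_def
proof (intro conjI ballI impI)
  show "convex {x \<in> S. L x = b}"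
    using assms unfolding convex_def
    by (auto simp: linear_add linear_scale simp flip: distrib_right)
next
  fix p q x assume pq: "p \<in> S" "q \<in> S" "x \<in> {x \<in> S. L x = b}" "x \<in> open_segment p q"
  then obtain u where u: "0 < u" "u < 1" "x = (1 - u) *\<^sub>R p + u *\<^sub>R q"
    by (auto simp: in_segment)
  have eq: "(1 - u) * L p + u * L q = b"
    using pq u assms(1) by (simp add: linear_add linear_scale)
  have le: "(1 - u) * L p \<le> (1 - u) * b" "u * L q \<le> u * b"
    using assms(3) pq u by (simp_all add: mult_left_mono)
  have "(1 - u) * L p = (1 - u) * b" "u * L q = u * b"
    using eq le by (smt (verit, best) distrib_right mult_cancel_right1)+
  then show "p \<in> {x \<in> S. L x = b}" "q \<in> {x \<in> S. L x = b}"
    using pq u by auto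
qed auto

text \<open>The points strictly below the level \<open>b\<close> together with the convex hull of the generators on
  that level form a convex set containing all generators.\<close>
lemma maximal_level_of_convex_hull:
  fixes L :: "'a::real_vector \<Rightarrow> real"
  assumes L: "linear L" and le: "\<And>x. x \<in> X \<Longrightarrow> L x \<le> b"
  shows "{x \<in> convex hull X. L x = b} = convex hull {x \<in> X. L x = b}"
    and "\<And>x. x \<in> convex hull X \<Longrightarrow> L x \<le> b"
proof -
  let ?K = "convex hull {x \<in> X. L x = b}"
  have KL: "L x = b" if "x \<in> ?K" for x
  proof -
    have "convex {x. L x = b}"
      using L unfolding convex_def by (auto simp: linear_add linear_scale simp flip: distrib_right)
    then have "?K \<subseteq> {x. L x = b}" by (intro hull_minimal) auto
    then show ?thesis using that by auto
  qed
  have "convex ({x. L x < b} \<union> ?K)"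
    unfolding convex_alt[of "_ \<union> _"]
  proof (intro ballI allI impI)
    fix x y and u :: real
    assume xy: "x \<in> {x. L x < b} \<union> ?K" "y \<in> {x. L x < b} \<union> ?K" and u: "0 \<le> u \<and> u \<le> 1"
    show "(1 - u) *\<^sub>R x + u *\<^sub>R y \<in> {x. L x < b} \<union> ?K"
    proof (cases "x \<in> ?K \<and> y \<in> ?K \<or> u = 0 \<or> u = 1")
      case True
      then show ?thesis using u xy convexD_alt[OF convex_convex_hull, of x "{x \<in> X. L x = b}" y u] by auto
    next
      case False
      then have u': "0 < u" "u < 1" using u by auto
      have "L x \<le> b" "L y \<le> b" "L x < b \<or> L y < b" using xy KL False by fastforce+
      then have "(1 - u) * L x + u * L y < (1 - u) * b + u * b"
        using u' by (smt (verit) mult_left_mono mult_strict_left_mono)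
      then have "L ((1 - u) *\<^sub>R x + u *\<^sub>R y) < b"
        using linear_add[OF L] linear_scale[OF L] by (simp only: real_scaleR_def distrib_right[symmetric]) simp
      then show ?thesis by simp
    qed
  qed
  then have sub: "convex hull X \<subseteq> {x. L x < b} \<union> ?K"
    by (intro hull_minimal) (use le in \<open>force intro: hull_inc\<close>)
  show "L x \<le> b" if "x \<in> convex hull X" for x
    using sub KL that by force
  have "?K \<subseteq> convex hull X" by (rule hull_mono) auto
  then show "{x \<in> convex hull X. L x = b} = ?K"
    using sub KL by auto
qed

corollary convex_hull_maximal_level_face_of:
  fixes L :: "'a::real_vector \<Rightarrow> real"
  assumes "linear L" "\<And>x. x \<in> X \<Longrightarrow> L x \<le> b"
  shows "convex hull {x \<in> X. L x = b} face_of convex hull X"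
  using maximal_level_face_of[OF assms(1) convex_convex_hull, of X b]
    maximal_level_of_convex_hull[OF assms] by simp

text \<open>A generating subset of least cardinality consists of extreme points: a generator inside an
  open segment of the hull could be dropped.\<close>
lemma convex_hull_eq_hull_of_extreme_points:
  fixes V :: "'a::real_vector set"
  assumes "finite V"
  shows "convex hull V = convex hull (vertices (convex hull V))"
proof -
  have sub: "vertices (convex hull V) \<subseteq> V"
    unfolding vertices_def using extreme_point_of_convex_hull by blast
  have "\<exists>W. (W \<subseteq> V \<and> convex hull W = convex hull V) \<and>
          (\<forall>W'. W' \<subseteq> V \<and> convex hull W' = convex hull V \<longrightarrow> card W \<le> card W')"
    by (rule ex_has_least_nat[of "\<lambda>W. W \<subseteq> V \<and> convex hull W = convex hull V" V]) simp
  then obtain W where W: "W \<subseteq> V" "convex hull W = convex hull V"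
    and min: "\<forall>W'. W' \<subseteq> V \<and> convex hull W' = convex hull V \<longrightarrow> card W \<le> card W'"
    by (elim exE conjE)
  have finW: "finite W" using W assms finite_subset by blast
  have "w extreme_point_of (convex hull W)" if w: "w \<in> W" for w
  proof (rule ccontr)
    assume "\<not> w extreme_point_of (convex hull W)"
    then obtain a b where ab: "a \<in> convex hull W" "b \<in> convex hull W" "w \<in> open_segment a b"
      using w by (auto simp: extreme_point_of_def hull_inc)
    let ?W = "W - {w}"
    have notin: "w \<notin> convex hull ?W"
    proof
      assume "w \<in> convex hull ?W"
      then have "convex hull ?W = convex hull W"
        using hull_redundant[of w convex ?W] w by (simp add: insert_absorb)
      then have "card W \<le> card ?W" using min W by (metis Diff_subset order_trans)
      then show False using w finW by (metis card_Diff1_less not_le)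
    qed
    have ins: "convex hull W = convex hull (insert w ?W)" using w by (simp add: insert_absorb)
    have ne: "?W \<noteq> {}"
    proof
      assume "?W = {}"
      then have "W = {w}" using w by auto
      then have "convex hull W = {w}" by simp
      then show False using ab by (auto simp: open_segment_def)
    qed
    have mix: "\<exists>s p. 0 \<le> s \<and> s \<le> 1 \<and> p \<in> convex hull ?W \<and> x = (1 - s) *\<^sub>R w + s *\<^sub>R p"
      if "x \<in> convex hull W" for x
    proof -
      have "x \<in> convex hull (insert w ?W)" using that ins by (rule subst[rotated])
      then obtain u v p where "0 \<le> u" "0 \<le> v" "u + v = 1" "p \<in> convex hull ?W" "x = u *\<^sub>R w + v *\<^sub>R p"
        unfolding convex_hull_insert[OF ne] by blast
      moreover have "u = 1 - v" using \<open>u + v = 1\<close> by simp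
      ultimately have "0 \<le> v \<and> v \<le> 1 \<and> p \<in> convex hull ?W \<and> x = (1 - v) *\<^sub>R w + v *\<^sub>R p"
        by simp
      then show ?thesis by blast
    qed
    \<comment> \<open>Both end points are mixtures of \<open>w\<close> and a point of the smaller hull;
      solving for \<open>w\<close> puts \<open>w\<close> into the smaller hull.\<close>
    obtain s p where s: "0 \<le> s" "s \<le> 1" "p \<in> convex hull ?W" "a = (1 - s) *\<^sub>R w + s *\<^sub>R p"
      using mix[OF ab(1)] by blast
    obtain t q where t: "0 \<le> t" "t \<le> 1" "q \<in> convex hull ?W" "b = (1 - t) *\<^sub>R w + t *\<^sub>R q"
      using mix[OF ab(2)] by blast
    obtain u where u: "0 < u" "u < 1" "w = (1 - u) *\<^sub>R a + u *\<^sub>R b" and "a \<noteq> b"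
      using ab(3) by (auto simp: in_segment)
    let ?c = "(1 - u) * s + u * t"
    have c: "?c *\<^sub>R w = ((1 - u) * s) *\<^sub>R p + (u * t) *\<^sub>R q"
    proof -
      have "w = (1 - u) *\<^sub>R ((1 - s) *\<^sub>R w + s *\<^sub>R p) + u *\<^sub>R ((1 - t) *\<^sub>R w + t *\<^sub>R q)"
        using u s t by simp
      also have "\<dots> = w - ?c *\<^sub>R w + (((1 - u) * s) *\<^sub>R p + (u * t) *\<^sub>R q)"
        by (simp add: algebra_simps)
      finally show ?thesis by (simp add: algebra_simps)
    qed
    have nn: "0 \<le> (1 - u) * s" "0 \<le> u * t" using u s t by auto
    have "?c \<noteq> 0"
    proof
      assume "?c = 0"
      then have "(1 - u) * s = 0" "u * t = 0" using nn by linarith+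
      then have "s = 0" "t = 0" using u by auto
      then show False using s t \<open>a \<noteq> b\<close> by simp
    qed
    then have cpos: "?c > 0" using nn by linarith
    have "w = (1 / ?c) *\<^sub>R (?c *\<^sub>R w)" using cpos by simp
    also have "\<dots> = ((1 - u) * s / ?c) *\<^sub>R p + (u * t / ?c) *\<^sub>R q"
      unfolding c by (simp add: scaleR_add_right)
    also have "\<dots> \<in> convex hull ?W"
      using s t nn cpos
      by (intro convexD[OF convex_convex_hull]) (simp_all flip: add_divide_distrib)
    finally show False using notin by simp
  qed
  then have "W \<subseteq> vertices (convex hull V)"
    unfolding vertices_def W(2) by blast
  then have "convex hull W \<subseteq> convex hull (vertices (convex hull V))"
    by (rule hull_mono)
  then have "convex hull V \<subseteq> convex hull (vertices (convex hull V))"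
    by (simp only: W(2))
  moreover have "convex hull (vertices (convex hull V)) \<subseteq> convex hull V"
    using sub by (rule hull_mono)
  ultimately show "convex hull V = convex hull (vertices (convex hull V))"
    by (rule subset_antisym)
qed

section \<open>Faces of tensor products\<close>

abbreviation lookup :: "('a \<Rightarrow>\<^sub>0 'b::zero) \<Rightarrow> 'a \<Rightarrow> 'b" where "lookup \<equiv> Poly_Mapping.lookup"

abbreviation single :: "'a \<Rightarrow> 'b \<Rightarrow> ('a \<Rightarrow>\<^sub>0 'b::zero)" where "single \<equiv> Poly_Mapping.single"

abbreviation keys :: "('a \<Rightarrow>\<^sub>0 'b::zero) \<Rightarrow> 'a set" where "keys \<equiv> Poly_Mapping.keys"

lemma lookup_scaleR [simp]: "lookup (c *\<^sub>R x) a = c *\<^sub>R lookup x a"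
  by (cases "c = 0") (simp_all add: scaleR_poly_mapping_def)

lemma lookup_tensor_vec [simp]: "lookup (tensor_vec p q) (a, b) = lookup p a * lookup q b"
proof -
  have "lookup (tensor_vec p q) (a, b)
      = (\<Sum>x \<in> keys p \<times> keys q. if x = (a, b) then lookup p a * lookup q b else 0)"
    unfolding tensor_vec_def lookup_sum
    by (intro sum.cong refl) (auto simp: lookup_single when_def split: prod.splits)
  also have "\<dots> = lookup p a * lookup q b"
    by (auto simp: in_keys_iff)
  finally show ?thesis .
qed

lemma affine_map_on_tensor:
  "affine_map_on UNIV (\<lambda>p. (p, w, tensor_vec p w))"
  unfolding affine_map_on_def
proof (intro ballI allI impI)
  fix x y :: "'a \<Rightarrow>\<^sub>0 real" and u v :: real
  assume "u + v = 1"
  then have "u *\<^sub>R w + v *\<^sub>R w = w" by (simp flip: scaleR_left_distrib)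
  moreover have "tensor_vec (u *\<^sub>R x + v *\<^sub>R y) w = u *\<^sub>R tensor_vec x w + v *\<^sub>R tensor_vec y w"
    by (rule poly_mapping_eqI) (auto simp: lookup_add algebra_simps)
  ultimately show "(u *\<^sub>R x + v *\<^sub>R y, w, tensor_vec (u *\<^sub>R x + v *\<^sub>R y) w) =
    u *\<^sub>R (x, w, tensor_vec x w) + v *\<^sub>R (y, w, tensor_vec y w)"
    by simp
qed

text \<open>Both functionals depend on one factor only, so that their sum is a linear functional on the
  tensor body; it is maximal exactly where both are.\<close>
lemma tensor_body_face:
  fixes f :: "('a \<Rightarrow>\<^sub>0 real) \<Rightarrow> real" and g :: "('b \<Rightarrow>\<^sub>0 real) \<Rightarrow> real"
  assumes lin: "linear f" "linear g" and P: "convex P"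
    and le: "\<And>p. p \<in> P \<Longrightarrow> f p \<le> b" "\<And>q. q \<in> Q \<Longrightarrow> g q \<le> c"
    and w: "{q \<in> Q. g q = c} = {w}"
  shows "(\<lambda>p. (p, w, tensor_vec p w)) ` {p \<in> P. f p = b} face_of tensor_body P Q"
proof -
  let ?X = "{(p, q, tensor_vec p q) |p q. p \<in> P \<and> q \<in> Q}"
  let ?L = "\<lambda>(x, y, z). f x + g y"
  let ?T = "\<lambda>p. (p, w, tensor_vec p w)"
  have L: "linear ?L"
    using lin by (auto simp: linear_iff algebra_simps)
  have X: "?L x \<le> b + c" if "x \<in> ?X" for x
    using that le by (auto intro: add_mono)
  have "{x \<in> ?X. ?L x = b + c} = ?T ` {p \<in> P. f p = b}" (is "?A = ?B")
  proof
    show "?A \<subseteq> ?B"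
    proof
      fix x assume "x \<in> ?A"
      then obtain p q where x: "x = (p, q, tensor_vec p q)" "p \<in> P" "q \<in> Q" "f p + g q = b + c"
        by auto
      then have "f p = b" "g q = c" using le(1)[of p] le(2)[of q] by linarith+
      then have "q \<in> {q \<in> Q. g q = c}" using x by simp
      then have "q = w" unfolding w by simp
      then show "x \<in> ?B" using x \<open>f p = b\<close> by simp
    qed
    show "?B \<subseteq> ?A" using w by auto
  qed
  moreover have "convex {p \<in> P. f p = b}"
    using maximal_level_face_of[OF lin(1) P le(1)] by (simp add: face_of_imp_convex)
  ultimately have "convex hull {x \<in> ?X. ?L x = b + c} = ?T ` {p \<in> P. f p = b}"
    by (simp add: affine_map_image_convex_hull[OF affine_map_on_tensor, symmetric] hull_same)
  moreover have "convex hull {x \<in> ?X. ?L x = b + c} face_of convex hull ?X"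
    by (rule convex_hull_maximal_level_face_of[OF L X])
  ultimately show ?thesis by (simp only: tensor_body_def)
qed

section \<open>Faces of symmetric powers\<close>

lemma sym_of_vec_eq_sum:
  assumes "finite A" "keys p \<subseteq> A"
  shows "sym_of_vec p = (\<Sum>a\<in>A. single (single a 1) (lookup p a))"
  unfolding sym_of_vec_def
  by (rule sum.mono_neutral_left) (use assms in \<open>auto simp: in_keys_iff\<close>)

text \<open>The index set of the sum defining \<open>sym_of_vec\<close> depends on its argument; linearity appears after
  enlarging the index sets to a common one.\<close>
lemma sym_of_vec_add: "sym_of_vec (p + q) = sym_of_vec p + sym_of_vec q"
proof -
  let ?A = "keys p \<union> keys q"
  have "keys (p + q) \<subseteq> ?A" by (rule keys_add)
  then show ?thesis
    by (simp add: sym_of_vec_eq_sum[of ?A] lookup_add single_add sum.distrib)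
qed

lemma sym_of_vec_scaleR: "sym_of_vec (c *\<^sub>R p) = c *\<^sub>R sym_of_vec p"
proof -
  let ?A = "keys p"
  have "keys (c *\<^sub>R p) \<subseteq> ?A" by (auto simp: in_keys_iff)
  moreover have "c *\<^sub>R single k x = single k (c * x)" for k :: "'a \<Rightarrow>\<^sub>0 nat" and x
    by (rule poly_mapping_eqI) (simp add: lookup_single when_def)
  ultimately show ?thesis
    by (simp add: sym_of_vec_eq_sum[of ?A] scaleR_sum_right)
qed

lemma lookup_sym_of_vec: "lookup (sym_of_vec p) (single a 1) = lookup p a"
proof -
  have "lookup (sym_of_vec p) (single a 1)
      = (\<Sum>x\<in>keys p. if x = a then lookup p a else 0)"
    unfolding sym_of_vec_def lookup_sum
    by (intro sum.cong refl) (auto simp: lookup_single when_def dest!: arg_cong[where f = "\<lambda>x. lookup x a"])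
  then show ?thesis by (auto simp: in_keys_iff)
qed

lemma single_sum_eq_double:
  "single x (1::nat) + single y 1 = single a 2 \<longleftrightarrow> x = a \<and> y = a"
proof
  assume "single x (1::nat) + single y 1 = single a 2"
  then have "lookup (single x (1::nat) + single y 1) a = 2" by simp
  then show "x = a \<and> y = a" by (auto simp: lookup_add lookup_single when_def split: if_splits)
qed (simp flip: single_add add: numeral_2_eq_2)

lemma lookup_sym_of_vec_square:
  "lookup (sym_of_vec p ^ 2) (single a 2) = (lookup p a)\<^sup>2"
proof -
  let ?K = "keys p"
  have "lookup (sym_of_vec p ^ 2) (single a 2)
      = (\<Sum>x\<in>?K. \<Sum>y\<in>?K. if x = a then if y = a then (lookup p a)\<^sup>2 else 0 else 0)"
    unfolding sym_of_vec_def power2_eq_square sum_product lookup_sum mult_single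
    by (intro sum.cong refl) (simp add: lookup_single when_def single_sum_eq_double power2_eq_square del: One_nat_def)
  also have "\<dots> = (\<Sum>x\<in>?K. if x = a then (lookup p a)\<^sup>2 else 0)"
    by (intro sum.cong refl) (auto simp: in_keys_iff)
  finally show ?thesis by (auto simp: in_keys_iff)
qed

lemma scaleR_mult_poly_mapping:
  fixes p q :: "('a \<Rightarrow>\<^sub>0 nat) \<Rightarrow>\<^sub>0 real"
  shows "(c *\<^sub>R p) * q = c *\<^sub>R (p * q)"
proof -
  have *: "c *\<^sub>R p = single 0 c * p" for p :: "('a \<Rightarrow>\<^sub>0 nat) \<Rightarrow>\<^sub>0 real"
    by (rule poly_mapping_eqI) (simp flip: mult_map_scale_conv_mult add: map.rep_eq when_def)
  show ?thesis by (simp add: * mult.assoc)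
qed

lemma elem_sym_split:
  assumes "finite A" "i \<notin> A"
  shows "(\<Sum>J | J \<subseteq> insert i A \<and> card J = Suc j. \<Prod>k\<in>J. x k :: 'r::comm_ring_1) =
     (\<Sum>J | J \<subseteq> A \<and> card J = Suc j. \<Prod>k\<in>J. x k) + x i * (\<Sum>J | J \<subseteq> A \<and> card J = j. \<Prod>k\<in>J. x k)"
proof -
  let ?S = "\<lambda>j. {J. J \<subseteq> A \<and> card J = j}"
  have fin: "finite J" if "J \<subseteq> A" for J using that assms finite_subset by blast
  have "{J. J \<subseteq> insert i A \<and> card J = Suc j} = ?S (Suc j) \<union> insert i ` ?S j" (is "?L = ?R")
  proof
    show "?R \<subseteq> ?L" using assms fin by (auto simp: card_insert_if) 
    show "?L \<subseteq> ?R"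
    proof
      fix J assume J: "J \<in> ?L"
      show "J \<in> ?R"
      proof (cases "i \<in> J")
        case True
        then have "J = insert i (J - {i})" "J - {i} \<in> ?S j"
          using J by (auto simp: card_Diff_singleton)
        then show ?thesis by blast
      qed (use J in auto)
    qed
  qed
  moreover have "?S (Suc j) \<inter> insert i ` ?S j = {}" using assms by auto
  moreover have "inj_on (insert i) (?S j)" using assms by (auto simp: inj_on_def)
  moreover have "(\<Prod>k\<in>insert i J. x k) = x i * (\<Prod>k\<in>J. x k)" if "J \<in> ?S j" for J
    using that assms fin by (subst prod.insert) auto
  ultimately show ?thesis
    using assms by (simp add: sum.union_disjoint sum.reindex sum_distrib_left)
qed

text \<open>If all but one of the arguments agree, the elementary symmetric polynomials are affine in
  the remaining one and independent of its position.\<close>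
lemma elem_sym_one_special:
  fixes x :: "nat \<Rightarrow> 'r::comm_ring_1"
  assumes i: "i \<in> {1..m}" and x: "\<And>k. k \<in> {1..m} \<Longrightarrow> k \<noteq> i \<Longrightarrow> x k = y" and j: "j \<ge> 1"
  shows "elem_sym m j x = of_nat ((m - 1) choose j) * y ^ j + x i * (of_nat ((m - 1) choose (j - 1)) * y ^ (j - 1))"
proof -
  obtain l where l: "j = Suc l" using j by (cases j) auto
  let ?A = "{1..m} - {i}"
  have "(\<Sum>J | J \<subseteq> ?A \<and> card J = k. \<Prod>k\<in>J. x k) = of_nat ((m - 1) choose k) * y ^ k" for k
  proof -
    have "(\<Prod>k\<in>J. x k) = y ^ k" if "J \<subseteq> ?A \<and> card J = k" for J
    proof -
      have "x l = y" if "l \<in> J" for l using that \<open>J \<subseteq> ?A \<and> card J = k\<close> x by blast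
      then have "(\<Prod>k\<in>J. x k) = (\<Prod>k\<in>J. y)" by (intro prod.cong) auto
      then show ?thesis using that by simp
    qed
    then have "(\<Sum>J | J \<subseteq> ?A \<and> card J = k. \<Prod>k\<in>J. x k) = (\<Sum>J | J \<subseteq> ?A \<and> card J = k. y ^ k)"
      by (intro sum.cong) auto
    then show ?thesis using i by (simp add: n_subsets)
  qed
  moreover have "insert i ?A = {1..m}" using i by auto
  ultimately show ?thesis
    using elem_sym_split[of ?A i x l] unfolding elem_sym_def l by simp
qed

lemma elem_sym_Suc: "elem_sym (Suc m) (Suc j) x = elem_sym m (Suc j) x + x (Suc m) * elem_sym m j x"
  using elem_sym_split[of "{1..m}" "Suc m" x j]
  by (simp add: elem_sym_def atLeastAtMostSuc_conv)

lemma elem_sym_1: "elem_sym m 1 x = (\<Sum>i = 1..m. x i)"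
proof (induction m)
  case (Suc m)
  have "{J. J \<subseteq> {1..m} \<and> card J = 0} = {{}}" by (auto dest: finite_subset)
  then have "elem_sym m 0 x = 1" unfolding elem_sym_def by simp
  then show ?case using Suc elem_sym_Suc[of m 0 x] by simp
next
  case 0
  have "{J. J \<subseteq> {1..0::nat} \<and> card J = 1} = {}" by auto
  then show ?case by (simp only: elem_sym_def) simp
qed

text \<open>The identity that turns sums and sums of squares of coordinates into a coefficient of \<open>e\<^sub>2\<close>.\<close>
lemma square_sum_eq_elem_sym:
  "(\<Sum>i = 1..m. x i)\<^sup>2 = (\<Sum>i = 1..m. (x i)\<^sup>2) + 2 * elem_sym m 2 x"
proof (induction m)
  case (Suc m)
  have "elem_sym (Suc m) 2 x = elem_sym m 2 x + x (Suc m) * (\<Sum>i = 1..m. x i)"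
    using elem_sym_Suc[of m 1 x] by (simp only: elem_sym_1 Suc_1)
  then show ?case using Suc by (simp add: power2_sum algebra_simps)
next
  case 0
  have "{J. J \<subseteq> {1..0::nat} \<and> card J = 2} = {}" by auto
  then show ?case by (simp only: elem_sym_def) simp
qed

definition sym_tuple :: "nat \<Rightarrow> (nat \<Rightarrow> 'a \<Rightarrow>\<^sub>0 real) \<Rightarrow> (nat \<Rightarrow>\<^sub>0 (('a \<Rightarrow>\<^sub>0 nat) \<Rightarrow>\<^sub>0 real))" where
  "sym_tuple m p = (\<Sum>j = 1..m. single j (elem_sym m j (\<lambda>i. sym_of_vec (p i))))"

lemma lookup_sym_tuple:
  assumes "1 \<le> j" "j \<le> m"
  shows "lookup (sym_tuple m p) j = elem_sym m j (\<lambda>i. sym_of_vec (p i))"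
proof -
  have "lookup (sym_tuple m p) j
      = (\<Sum>k = 1..m. if k = j then elem_sym m j (\<lambda>i. sym_of_vec (p i)) else 0)"
    unfolding sym_tuple_def lookup_sum by (intro sum.cong refl) (simp add: lookup_single)
  then show ?thesis using assms by simp
qed

lemma lookup_sym_tuple_1:
  assumes "m \<ge> 1"
  shows "lookup (lookup (sym_tuple m p) 1) (single a 1) = (\<Sum>i = 1..m. lookup (p i) a)"
  using assms by (simp only: lookup_sym_tuple elem_sym_1 lookup_sum lookup_sym_of_vec)

text \<open>The coefficient of \<open>X\<^sub>a\<^sup>2\<close> in \<open>e\<^sub>2\<close> sees only the coordinates \<open>a\<close> of the arguments.\<close>
lemma lookup_sym_tuple_2:
  assumes "m \<ge> 2"
  shows "2 * lookup (lookup (sym_tuple m p) 2) (single a 2)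
    = (\<Sum>i = 1..m. lookup (p i) a)\<^sup>2 - (\<Sum>i = 1..m. (lookup (p i) a)\<^sup>2)"
proof -
  let ?e = "elem_sym m 2 (\<lambda>i. sym_of_vec (p i))"
  have sum: "(\<Sum>i = 1..m. sym_of_vec (p i)) = sym_of_vec (\<Sum>i = 1..m. p i)"
    by (induction m) (simp_all add: sym_of_vec_add sym_of_vec_def[of 0])
  have "lookup (sym_of_vec (\<Sum>i = 1..m. p i) ^ 2) (single a 2)
      = (\<Sum>i = 1..m. lookup (sym_of_vec (p i) ^ 2) (single a 2)) + 2 * lookup ?e (single a 2)"
    using square_sum_eq_elem_sym[of "\<lambda>i. sym_of_vec (p i)" m]
    unfolding sum mult_2 by (simp only: lookup_add lookup_sum)
  then have "(\<Sum>i = 1..m. lookup (p i) a)\<^sup>2 = (\<Sum>i = 1..m. (lookup (p i) a)\<^sup>2) + 2 * lookup ?e (single a 2)"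
    unfolding lookup_sym_of_vec_square lookup_sum .
  then show ?thesis using assms by (simp add: lookup_sym_tuple)
qed

lemma sym_tuple_one_special:
  assumes "i \<in> {1..m}" and "\<And>k. k \<in> {1..m} \<Longrightarrow> k \<noteq> i \<Longrightarrow> p k = w"
  shows "sym_tuple m p = (\<Sum>j = 1..m. single j (of_nat ((m - 1) choose j) * sym_of_vec w ^ j
           + sym_of_vec (p i) * (of_nat ((m - 1) choose (j - 1)) * sym_of_vec w ^ (j - 1))))"
  unfolding sym_tuple_def
  using assms by (intro sum.cong refl arg_cong[where f = "single _"] elem_sym_one_special) auto

text \<open>The point of the symmetric power given by the multiset \<open>{x, w, \<dots>, w}\<close>.\<close>
definition pencil :: "nat \<Rightarrow> ('a \<Rightarrow>\<^sub>0 real) \<Rightarrow> ('a \<Rightarrow>\<^sub>0 real) \<Rightarrow> (nat \<Rightarrow>\<^sub>0 (('a \<Rightarrow>\<^sub>0 nat) \<Rightarrow>\<^sub>0 real))" where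
  "pencil m w x = sym_tuple m (\<lambda>i. if i = 1 then x else w)"

lemma pencil_eq:
  assumes "m \<ge> 1"
  shows "pencil m w x = (\<Sum>j = 1..m. single j (of_nat ((m - 1) choose j) * sym_of_vec w ^ j
           + sym_of_vec x * (of_nat ((m - 1) choose (j - 1)) * sym_of_vec w ^ (j - 1))))"
  unfolding pencil_def using assms
  by (subst sym_tuple_one_special[of 1 _ _ w]) auto

lemma sym_tuple_eq_pencil:
  assumes "i \<in> {1..m}" and "\<And>k. k \<in> {1..m} \<Longrightarrow> k \<noteq> i \<Longrightarrow> p k = w"
  shows "sym_tuple m p = pencil m w (p i)"
  using assms sym_tuple_one_special[of i m p w] pencil_eq[of m w "p i"] by auto

lemma affine_map_on_pencil:
  assumes "m \<ge> 1"
  shows "affine_map_on UNIV (pencil m w)"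
  unfolding affine_map_on_def
proof (intro ballI allI impI)
  fix x y :: "'a \<Rightarrow>\<^sub>0 real" and u v :: real
  assume "u + v = 1"
  then have one: "u *\<^sub>R a + v *\<^sub>R a = a" for a :: "('a \<Rightarrow>\<^sub>0 nat) \<Rightarrow>\<^sub>0 real"
    by (simp flip: scaleR_left_distrib)
  let ?A = "\<lambda>j. of_nat ((m - 1) choose j) * sym_of_vec w ^ j"
  let ?B = "\<lambda>j. of_nat ((m - 1) choose (j - 1)) * sym_of_vec w ^ (j - 1)"
  have pencil: "pencil m w x = (\<Sum>j = 1..m. single j (?A j + sym_of_vec x * ?B j))" for x
    using assms by (rule pencil_eq)
  have sc: "c *\<^sub>R single j a = single j (c *\<^sub>R a)" for c and j :: nat and a :: "('a \<Rightarrow>\<^sub>0 nat) \<Rightarrow>\<^sub>0 real"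
    by (rule poly_mapping_eqI) (simp add: lookup_single when_def)
  have "?A j + sym_of_vec (u *\<^sub>R x + v *\<^sub>R y) * ?B j
      = u *\<^sub>R (?A j + sym_of_vec x * ?B j) + v *\<^sub>R (?A j + sym_of_vec y * ?B j)" for j
    unfolding scaleR_add_right
    by (subst one[of "?A j", symmetric])
      (simp add: sym_of_vec_add sym_of_vec_scaleR scaleR_mult_poly_mapping distrib_right add_ac)
  then show "pencil m w (u *\<^sub>R x + v *\<^sub>R y) = u *\<^sub>R pencil m w x + v *\<^sub>R pencil m w y"
    unfolding pencil scaleR_sum_right sc single_add[symmetric] sum.distrib[symmetric] by simp
qed

lemma inj_pencil:
  assumes "m \<ge> 1"
  shows "inj (pencil m w)"
proof
  fix x y assume eq: "pencil m w x = pencil m w y"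
  have "(\<Sum>i = 1..m. lookup (if i = 1 then x else w) a) = lookup x a + (\<Sum>i = 2..m. lookup w a)" for x :: "'a \<Rightarrow>\<^sub>0 real" and a
    using assms by (simp add: sum.atLeast_Suc_atMost numeral_2_eq_2)
  then have *: "lookup (lookup (pencil m w x) 1) (single a 1) = lookup x a + (\<Sum>i = 2..m. lookup w a)" for x a
    unfolding pencil_def lookup_sym_tuple_1[OF assms] .
  show "x = y"
    using * eq by (intro poly_mapping_eqI) (metis add_right_cancel)
qed

text \<open>The functional used is \<open>\<Sum> f (p\<^sub>i)\<close>, read off from \<open>e\<^sub>1\<close>, minus the penalty
  \<open>(\<Sum> y\<^sub>i - 1)\<^sup>2 + \<Sum> y\<^sub>i (1 - y\<^sub>i)\<close> for \<open>y\<^sub>i = p\<^sub>i(e) + c\<close>. The squares of the individual \<open>y\<^sub>i\<close> cancel in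
  the penalty, and hence it is an affine function of \<open>e\<^sub>1\<close> and \<open>e\<^sub>2\<close>. As all \<open>y\<^sub>i\<close> lie in the unit
  interval, the penalty is zero only if all of them are 0 except for one, which is 1.\<close>
lemma sym_body_face:
  assumes m: "m \<ge> 2" and P: "convex P" and A: "finite A"
    and f: "\<And>p. f p = (\<Sum>a\<in>A. wt a * lookup p a)"
    and le: "\<And>p. p \<in> P \<Longrightarrow> f p \<le> b"
    and h: "\<And>p. p \<in> P \<Longrightarrow> 0 \<le> lookup p e + c" "\<And>p. p \<in> P \<Longrightarrow> lookup p e + c \<le> 1"
    and w: "{p \<in> P. f p = b \<and> lookup p e + c = 0} = {w}"
  shows "pencil m w ` {p \<in> P. f p = b \<and> lookup p e + c = 1} face_of sym_body m P"
proof -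
  let ?F = "{p \<in> P. f p = b \<and> lookup p e + c = 1}"
  let ?X = "{sym_tuple m p |p. \<forall>i\<in>{1..m}. p i \<in> P}"
  \<comment> \<open>The factor \<open>1 - 2 (m - 1) c\<close> and the constant in \<open>?b\<close> result from expanding the penalty
    for \<open>y\<^sub>i = x\<^sub>i + c\<close> into \<open>(\<Sum> x\<^sub>i)\<^sup>2 - \<Sum> x\<^sub>i\<^sup>2 = 2 e\<^sub>2(x)\<close> and \<open>\<Sum> x\<^sub>i = e\<^sub>1(x)\<close>.\<close>
  let ?L = "\<lambda>z. (\<Sum>a\<in>A. wt a * lookup (lookup z 1) (single a 1))
    + (1 - 2 * (real m - 1) * c) * lookup (lookup z 1) (single e 1) - 2 * lookup (lookup z 2) (single e 2)"
  let ?b = "m * b + (real m ^ 2 * c ^ 2 - m * c + 1 - m * c ^ 2)"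
  have L: "linear ?L"
    by (simp add: linear_iff lookup_add algebra_simps sum.distrib sum_distrib_left)
  have L_sym: "?L (sym_tuple m p) = (\<Sum>i = 1..m. f (p i))
      - (((\<Sum>i = 1..m. lookup (p i) e + c) - 1)\<^sup>2 + (\<Sum>i = 1..m. (lookup (p i) e + c) * (1 - (lookup (p i) e + c))))
      + (real m ^ 2 * c ^ 2 - m * c + 1 - m * c ^ 2)" for p
  proof -
    have m1: "m \<ge> 1" using m by simp
    have *: "(\<Sum>a\<in>A. wt a * lookup (lookup (sym_tuple m p) 1) (single a 1)) = (\<Sum>i = 1..m. f (p i))"
      unfolding lookup_sym_tuple_1[OF m1] f sum_distrib_left by (rule sum.swap)
    have **: "(\<Sum>i = 1..m. (lookup (p i) e + c) * (1 - (lookup (p i) e + c)))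
      = (1 - 2 * c) * (\<Sum>i = 1..m. lookup (p i) e) - (\<Sum>i = 1..m. (lookup (p i) e)\<^sup>2) + m * (c - c\<^sup>2)"
    proof -
      have "(\<Sum>i = 1..m. (lookup (p i) e + c) * (1 - (lookup (p i) e + c)))
          = (\<Sum>i = 1..m. (1 - 2 * c) * lookup (p i) e - (lookup (p i) e)\<^sup>2 + (c - c\<^sup>2))"
        by (intro sum.cong refl) (simp add: algebra_simps power2_eq_square)
      then show ?thesis by (simp add: sum.distrib sum_subtractf sum_distrib_left)
    qed
    have ***: "(\<Sum>i = 1..m. lookup (p i) e + c) = (\<Sum>i = 1..m. lookup (p i) e) + m * c"
      by (simp add: sum.distrib)
    show ?thesis
      unfolding *
      unfolding lookup_sym_tuple_1[OF m1] lookup_sym_tuple_2[OF m] ** ***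
      by (simp add: algebra_simps power2_eq_square)
  qed
  have X: "?L z \<le> ?b" if z: "z \<in> ?X" for z
  proof -
    obtain p where p: "z = sym_tuple m p" "\<And>i. i \<in> {1..m} \<Longrightarrow> p i \<in> P" using z by auto
    have "(\<Sum>i = 1..m. f (p i)) \<le> m * b" using sum_bounded_above[of "{1..m}" "\<lambda>i. f (p i)" b] p le by simp
    moreover have "0 \<le> (\<Sum>i = 1..m. (lookup (p i) e + c) * (1 - (lookup (p i) e + c)))"
      using p h by (intro sum_nonneg mult_nonneg_nonneg) auto
    ultimately show ?thesis unfolding p(1) L_sym using zero_le_power2 by (smt (verit))
  qed
  have "{z \<in> ?X. ?L z = ?b} = pencil m w ` ?F" (is "?A = ?B")
  proof
    show "?A \<subseteq> ?B"
    proof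
      fix z assume "z \<in> ?A"
      then obtain p where p: "z = sym_tuple m p" "\<And>i. i \<in> {1..m} \<Longrightarrow> p i \<in> P"
        and eq: "?L (sym_tuple m p) = ?b" by auto
      define y where "y i = lookup (p i) e + c" for i
      have y: "0 \<le> y i * (1 - y i)" if "i \<in> {1..m}" for i
        using h p that unfolding y_def by (intro mult_nonneg_nonneg) auto
      have le1: "(\<Sum>i = 1..m. f (p i)) \<le> m * b"
        using sum_bounded_above[of "{1..m}" "\<lambda>i. f (p i)" b] p le by simp
      have le2: "0 \<le> (\<Sum>i = 1..m. y i * (1 - y i))"
        using y by (intro sum_nonneg) auto
      have eqs: "(\<Sum>i = 1..m. f (p i)) = m * b" "(\<Sum>i = 1..m. y i * (1 - y i)) = 0" "(\<Sum>i = 1..m. y i) = 1"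
        using eq le1 le2 zero_le_power2[of "(\<Sum>i = 1..m. y i) - 1"]
        unfolding L_sym y_def[symmetric] by (smt (verit) zero_eq_power2)+
      have fb: "f (p i) = b" if "i \<in> {1..m}" for i
      proof -
        have "(\<Sum>i = 1..m. b - f (p i)) = 0" using eqs(1) by (simp add: sum_subtractf)
        then have "\<forall>i\<in>{1..m}. b - f (p i) = 0"
          using p le by (subst (asm) sum_nonneg_eq_0_iff) auto
        then show ?thesis using that by auto
      qed
      have "\<forall>i\<in>{1..m}. y i * (1 - y i) = 0"
        using eqs(2) y by (subst (asm) sum_nonneg_eq_0_iff) auto
      then have y01: "y i = 0 \<or> y i = 1" if "i \<in> {1..m}" for i using that by fastforce
      obtain i where i: "i \<in> {1..m}" "y i = 1"
      proof (rule ccontr)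
        assume "\<not> thesis"
        then have "(\<Sum>i = 1..m. y i) = 0" using y01 that by (intro sum.neutral) blast
        then show False using eqs(3) by simp
      qed
      have "(\<Sum>k \<in> {1..m} - {i}. y k) = 0" using eqs(3) i by (simp add: sum_diff1)
      moreover have "\<forall>k \<in> {1..m} - {i}. 0 \<le> y k" using y01 by fastforce
      ultimately have "\<forall>k \<in> {1..m} - {i}. y k = 0"
        by (subst (asm) sum_nonneg_eq_0_iff) auto
      then have "p k \<in> {p \<in> P. f p = b \<and> lookup p e + c = 0}" if "k \<in> {1..m}" "k \<noteq> i" for k
        using that p fb by (simp add: y_def)
      then have "p k = w" if "k \<in> {1..m}" "k \<noteq> i" for k
        using that unfolding w by simp
      then have "z = pencil m w (p i)"
        unfolding p using i by (intro sym_tuple_eq_pencil) auto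
      moreover have "p i \<in> ?F" using i fb p by (simp add: y_def)
      ultimately show "z \<in> ?B" by blast
    qed
    show "?B \<subseteq> ?A"
    proof
      fix z assume "z \<in> ?B"
      then obtain x where x: "z = pencil m w x" "x \<in> ?F" by blast
      have ww: "w \<in> P" "f w = b" "lookup w e + c = 0" using w by blast+
      let ?p = "\<lambda>i::nat. if i = 1 then x else w"
      have "(\<Sum>i = 1..m. f (?p i)) = (\<Sum>i = 1..m. b)"
        using x ww by (intro sum.cong) auto
      moreover have "(\<Sum>i = 1..m. lookup (?p i) e + c) = (\<Sum>i = 1..m. if i = 1 then 1 else 0)"
        using x ww by (intro sum.cong) auto
      moreover have "(\<Sum>i = 1..m. (lookup (?p i) e + c) * (1 - (lookup (?p i) e + c))) = 0"
        using x ww by (intro sum.neutral) auto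
      ultimately have "?L (sym_tuple m ?p) = ?b"
        unfolding L_sym using m by simp
      moreover have "\<forall>i\<in>{1..m}. ?p i \<in> P" using x ww by auto
      ultimately show "z \<in> ?A" unfolding x(1) pencil_def by blast
    qed
  qed
  \<comment> \<open>\<open>?F\<close> is a single level set: the one on which \<open>f + lookup _ e\<close> is maximal.\<close>
  moreover have "convex ?F"
  proof -
    have "linear (\<lambda>p. f p + lookup p e)"
      unfolding f by (simp add: linear_iff lookup_add algebra_simps sum.distrib sum_distrib_left)
    then have "{p \<in> P. f p + lookup p e = b + (1 - c)} face_of P"
      using le h by (intro maximal_level_face_of P) (smt (verit))+
    moreover have "{p \<in> P. f p + lookup p e = b + (1 - c)} = ?F"
      using le h by (smt (verit) Collect_cong)
    ultimately show ?thesis by (simp add: face_of_imp_convex)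
  qed
  ultimately have "convex hull {z \<in> ?X. ?L z = ?b} = pencil m w ` ?F"
    using m by (simp add: affine_map_image_convex_hull[OF affine_map_on_pencil, symmetric] hull_same)
  moreover have "convex hull {z \<in> ?X. ?L z = ?b} face_of convex hull ?X"
    by (rule convex_hull_maximal_level_face_of[OF L X])
  moreover have "sym_body m P = convex hull ?X"
    unfolding sym_body_def sym_tuple_def ..
  ultimately show ?thesis by (simp only:)
qed

section \<open>Hamiltonian cycles and cyclic permutations\<close>

text \<open>A permutation with a single cycle. Invariant subsets express this without iterating \<open>\<sigma>\<close>,
  and are easy to exclude or to exhibit.\<close>
definition cyclic_perm :: "'v set \<Rightarrow> ('v \<Rightarrow> 'v) \<Rightarrow> bool" where
  "cyclic_perm X \<sigma> \<longleftrightarrow> bij_betw \<sigma> X X \<and> (\<forall>Y\<subseteq>X. Y \<noteq> {} \<longrightarrow> \<sigma> ` Y \<subseteq> Y \<longrightarrow> Y = X)"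

text \<open>A node \<open>x\<close> of the digraph becomes an in-vertex \<open>2 * enc x\<close> and an out-vertex \<open>2 * enc x + 1\<close>; an
  arc runs from an out-vertex to an in-vertex.\<close>
definition node_edges :: "('v \<Rightarrow> nat) \<Rightarrow> 'v set \<Rightarrow> nat set set" where
  "node_edges enc X = (\<lambda>x. {2 * enc x, 2 * enc x + 1}) ` X"

definition arc_edges :: "('v \<Rightarrow> nat) \<Rightarrow> 'v set \<Rightarrow> ('v \<Rightarrow> 'v) \<Rightarrow> nat set set" where
  "arc_edges enc X \<sigma> = (\<lambda>x. {2 * enc x + 1, 2 * enc (\<sigma> x)}) ` X"

text \<open>The orbit of a point is invariant, hence everything; cut off at the first return it is an
  enumeration without repetition.\<close>
lemma cyclic_perm_enumeration:
  assumes "finite X" "X \<noteq> {}" and \<sigma>: "cyclic_perm X \<sigma>"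
  obtains p where "bij_betw p {..<card X} X" "p (card X) = p 0" "\<And>k. \<sigma> (p k) = p (Suc k)"
proof -
  obtain x0 where x0: "x0 \<in> X" using assms by auto
  define p where "p k = (\<sigma> ^^ k) x0" for k
  have step: "\<sigma> (p k) = p (Suc k)" for k by (simp add: p_def)
  have inX: "p k \<in> X" for k
    using \<sigma> x0 unfolding cyclic_perm_def p_def
    by (induction k) (auto dest: bij_betw_apply)
  have closed: "Y = X" if "Y \<subseteq> X" "Y \<noteq> {}" "\<sigma> ` Y \<subseteq> Y" for Y
    using \<sigma> that by (simp add: cyclic_perm_def)
  have "range (\<lambda>k. p (Suc k)) = X"
    by (rule closed) (use inX step in auto)
  then obtain k where "x0 = p (Suc k)" using x0 by blast
  then have ex: "\<exists>l. l > 0 \<and> p l = p 0"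
    by (intro exI[of _ "Suc k"]) (simp add: p_def)
  define l where "l = (LEAST l. l > 0 \<and> p l = p 0)"
  have l: "l > 0" "p l = p 0" using LeastI_ex[OF ex] by (auto simp: l_def)
  have least: "l \<le> k" if "k > 0" "p k = p 0" for k
    using that unfolding l_def by (simp add: Least_le)
  have img: "p ` {..<l} = X"
  proof (rule closed)
    show "\<sigma> ` (p ` {..<l}) \<subseteq> p ` {..<l}"
    proof clarsimp
      fix k assume "k < l"
      then show "\<sigma> (p k) \<in> p ` {..<l}"
        using l step by (cases "Suc k = l") auto
    qed
  qed (use inX l in auto)
  have neq: "p i \<noteq> p j" if "i < j" "j < l" for i j
  proof
    assume eq: "p i = p j"
    have "p (i + k) = p (j + k)" for k
      by (induction k) (use eq in \<open>auto simp flip: step\<close>)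
    from this[of "l - j"] have "p (i + (l - j)) = p 0" using that l by simp
    then show False using least[of "i + (l - j)"] that by simp
  qed
  have "inj_on p {..<l}"
    by (intro linorder_inj_onI') (use neq in auto)
  then have bij: "bij_betw p {..<l} X" using img by (simp add: bij_betw_def)
  then have "card X = l" using bij_betw_same_card by fastforce
  then show ?thesis using that bij l step by blast
qed

lemma hamiltonian_cycle_of_cyclic_perm:
  assumes enc: "bij_betw enc X {..<N}" and N: "N \<ge> 2" and \<sigma>: "cyclic_perm X \<sigma>"
  shows "hamiltonian_cycle (2 * N) (node_edges enc X \<union> arc_edges enc X \<sigma>)"
proof -
  have X: "finite X" "card X = N"
    using enc bij_betw_finite bij_betw_same_card by fastforce+
  then have "X \<noteq> {}" using N by auto
  obtain p where p: "bij_betw p {..<N} X" "p N = p 0" "\<And>k. \<sigma> (p k) = p (Suc k)"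
    using cyclic_perm_enumeration[OF X(1) \<open>X \<noteq> {}\<close> \<sigma>] X(2) by blast
  have pX: "p k \<in> X" if "k < N" for k using p(1) that bij_betw_apply by fastforce
  define g where "g k = 2 * enc (p (k div 2)) + k mod 2" for k
  define xs where "xs = map g [0..<2 * N]"
  have len: "length xs = 2 * N" by (simp add: xs_def)
  have "inj_on g {..<2 * N}"
  proof (rule inj_onI)
    fix i j assume ij: "i \<in> {..<2 * N}" "j \<in> {..<2 * N}" and eq: "g i = g j"
    have m: "i mod 2 = j mod 2" using arg_cong[OF eq, of "\<lambda>x. x mod 2"] by (simp add: g_def)
    then have "enc (p (i div 2)) = enc (p (j div 2))" using eq by (simp add: g_def)
    moreover have "i div 2 < N" "j div 2 < N" using ij by auto
    ultimately have "i div 2 = j div 2"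
      using enc p(1) pX by (metis (no_types, lifting) bij_betw_imp_inj_on inj_on_def lessThan_iff)
    then show "i = j" using m by (metis div_mult_mod_eq)
  qed
  then have dist: "distinct xs" by (simp add: xs_def distinct_map lessThan_atLeast0)
  have "set xs \<subseteq> {..<2 * N}"
  proof
    fix v assume "v \<in> set xs"
    then obtain k where k: "k < 2 * N" "v = g k" by (auto simp: xs_def)
    then have "enc (p (k div 2)) < N" using pX[of "k div 2"] bij_betw_apply[OF enc] by fastforce
    then show "v \<in> {..<2 * N}" using k by (simp add: g_def)
  qed
  then have set: "set xs = {..<2 * N}"
    using dist len by (intro card_subset_eq) (auto simp: distinct_card)
  have nth: "xs ! i = g i" "xs ! (Suc i mod (2 * N)) = g (Suc i)" if "i < 2 * N" for i
  proof -
    show "xs ! i = g i" using that by (simp add: xs_def)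
    show "xs ! (Suc i mod (2 * N)) = g (Suc i)"
    proof (cases "Suc i = 2 * N")
      case True
      then have "g (Suc i) = g 0" using p(2) by (simp add: g_def)
      then show ?thesis using True N by (simp add: xs_def)
    next
      case False
      then show ?thesis using that by (simp add: xs_def)
    qed
  qed
  have even: "{g (2 * j), g (Suc (2 * j))} = {2 * enc (p j), 2 * enc (p j) + 1}" for j
    by (simp add: g_def)
  have odd: "{g (Suc (2 * j)), g (Suc (Suc (2 * j)))} = {2 * enc (p j) + 1, 2 * enc (\<sigma> (p j))}" for j
    by (simp add: g_def p(3))
  have "{{xs ! i, xs ! (Suc i mod (2 * N))} |i. i < 2 * N} = (\<lambda>i. {g i, g (Suc i)}) ` {..<2 * N}"
  proof (intro equalityI subsetI)
    fix e assume "e \<in> {{xs ! i, xs ! (Suc i mod (2 * N))} |i. i < 2 * N}"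
    then obtain i where "i < 2 * N" "e = {xs ! i, xs ! (Suc i mod (2 * N))}" by blast
    then show "e \<in> (\<lambda>i. {g i, g (Suc i)}) ` {..<2 * N}" using nth by auto
  next
    fix e assume "e \<in> (\<lambda>i. {g i, g (Suc i)}) ` {..<2 * N}"
    then obtain i where "i < 2 * N" "e = {xs ! i, xs ! (Suc i mod (2 * N))}" using nth by auto
    then show "e \<in> {{xs ! i, xs ! (Suc i mod (2 * N))} |i. i < 2 * N}" by blast
  qed
  also have "{..<2 * N} = (\<lambda>j. 2 * j) ` {..<N} \<union> (\<lambda>j. Suc (2 * j)) ` {..<N}"
  proof (intro equalityI subsetI)
    fix i assume "i \<in> {..<2 * N}"
    then show "i \<in> (\<lambda>j. 2 * j) ` {..<N} \<union> (\<lambda>j. Suc (2 * j)) ` {..<N}"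
      by (cases "even i") (auto elim!: evenE oddE)
  qed auto
  also have "(\<lambda>i. {g i, g (Suc i)}) ` \<dots> = node_edges enc X \<union> arc_edges enc X \<sigma>"
    unfolding image_Un image_image even odd node_edges_def arc_edges_def
    unfolding bij_betw_imp_surj_on[OF p(1), symmetric] image_image ..
  finally show ?thesis
    unfolding hamiltonian_cycle_def using N dist set by (intro conjI exI[of _ xs]) auto
qed

text \<open>A Hamiltonian cycle as a periodic walk through the vertices. Unlike a list it can start anywhere
  and be reversed by a substitution in the argument.\<close>
definition tour :: "nat \<Rightarrow> nat set set \<Rightarrow> (nat \<Rightarrow> nat) \<Rightarrow> bool" where
  "tour n C g \<longleftrightarrow> (\<forall>k l. g k = g l \<longleftrightarrow> k mod n = l mod n) \<and> range g = {..<n} \<and>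
     C = range (\<lambda>k. {g k, g (Suc k)})"

lemma hamiltonian_cycle_tour:
  assumes "hamiltonian_cycle n C"
  obtains g where "tour n C g"
proof -
  obtain xs where xs: "n \<ge> 3" "distinct xs" "set xs = {..<n}"
      "C = {{xs ! i, xs ! (Suc i mod n)} |i. i < n}"
    using assms by (auto simp: hamiltonian_cycle_def)
  have len: "length xs = n" using xs distinct_card by fastforce
  let ?g = "\<lambda>k. xs ! (k mod n)"
  have "tour n C ?g"
    unfolding tour_def
  proof (intro conjI allI)
    show "?g k = ?g l \<longleftrightarrow> k mod n = l mod n" for k l
      using xs(1) by (intro nth_eq_iff_index_eq[OF xs(2)]) (simp_all add: len)
    show "range ?g = {..<n}"
    proof
      show "range ?g \<subseteq> {..<n}" using xs(1) len unfolding xs(3)[symmetric] by (auto intro!: nth_mem mod_less_divisor)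
      show "{..<n} \<subseteq> range ?g"
      proof
        fix v assume "v \<in> {..<n}"
        then obtain i where "i < n" "v = xs ! i" using xs len by (metis in_set_conv_nth)
        then have "v = ?g i" by simp
        then show "v \<in> range ?g" by blast
      qed
    qed
    show "C = range (\<lambda>k. {?g k, ?g (Suc k)})"
    proof
      show "C \<subseteq> range (\<lambda>k. {?g k, ?g (Suc k)})"
      proof
        fix e assume "e \<in> C"
        then obtain i where "i < n" "e = {xs ! i, xs ! (Suc i mod n)}" unfolding xs(4) by blast
        then have "e = {?g i, ?g (Suc i)}" by simp
        then show "e \<in> range (\<lambda>k. {?g k, ?g (Suc k)})" by blast
      qed
      show "range (\<lambda>k. {?g k, ?g (Suc k)}) \<subseteq> C"
      proof clarify
        fix k
        have "{?g k, ?g (Suc k)} = {xs ! (k mod n), xs ! (Suc (k mod n) mod n)}" by (simp add: mod_Suc_eq)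
        moreover have "k mod n < n" using xs by simp
        ultimately show "{?g k, ?g (Suc k)} \<in> C" unfolding xs(4) by blast
      qed
    qed
  qed
  then show ?thesis using that by blast
qed

lemma tour_shift:
  assumes g: "tour n C g" and "n > 0"
  shows "tour n C (\<lambda>k. g (k + c))"
proof -
  have eq: "g k = g l \<longleftrightarrow> k mod n = l mod n" for k l using g by (simp add: tour_def)
  have wrap: "g k = g (k + (n - 1) * c + c)" "g (Suc k) = g (Suc (k + (n - 1) * c) + c)" for k
  proof -
    have e: "k + (n - 1) * c + c = k + n * c" "Suc (k + (n - 1) * c) + c = Suc k + n * c"
      using assms(2) by (cases n; simp)+
    show "g k = g (k + (n - 1) * c + c)" "g (Suc k) = g (Suc (k + (n - 1) * c) + c)"
      unfolding eq e by simp_all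
  qed
  have "range (\<lambda>k. g (k + c)) = range g"
  proof
    show "range g \<subseteq> range (\<lambda>k. g (k + c))"
      by (rule image_subsetI) (subst wrap(1), rule rangeI)
  qed auto
  moreover have "range (\<lambda>k. {g (k + c), g (Suc k + c)}) = range (\<lambda>k. {g k, g (Suc k)})"
  proof
    show "range (\<lambda>k. {g k, g (Suc k)}) \<subseteq> range (\<lambda>k. {g (k + c), g (Suc k + c)})"
    proof (rule image_subsetI)
      fix k
      let ?k = "k + (n - 1) * c"
      have "{g k, g (Suc k)} = {g (?k + c), g (Suc ?k + c)}" using wrap[of k] by metis
      then show "{g k, g (Suc k)} \<in> range (\<lambda>k. {g (k + c), g (Suc k + c)})" by blast
    qed
    show "range (\<lambda>k. {g (k + c), g (Suc k + c)}) \<subseteq> range (\<lambda>k. {g k, g (Suc k)})"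
      unfolding add_Suc by (rule image_subsetI) (rule rangeI)
  qed
  moreover have "(k + c) mod n = (l + c) mod n \<longleftrightarrow> k mod n = l mod n" for k l
  proof
    assume "(k + c) mod n = (l + c) mod n"
    then have "(k + c + (n - 1) * c) mod n = (l + c + (n - 1) * c) mod n" by (rule mod_add_cong) simp
    moreover have "i + c + (n - 1) * c = i + n * c" for i using assms(2) by (cases n) auto
    ultimately show "k mod n = l mod n" by (simp only: mod_mult_self2)
  qed (rule mod_add_cong, simp_all)
  ultimately show ?thesis using g by (simp add: tour_def)
qed

text \<open>Modulo \<open>n\<close>, multiplication by \<open>n - 1\<close> is negation.\<close>
lemma tour_reverse:
  assumes g: "tour n C g" and n: "n \<ge> 2"
  shows "tour n C (\<lambda>k. g ((n - 1) * k))"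
proof -
  have eq: "g k = g l \<longleftrightarrow> k mod n = l mod n" for k l using g by (simp add: tour_def)
  have inv: "(n - 1) * ((n - 1) * k) mod n = k mod n" for k
  proof -
    obtain r where "n = Suc (Suc r)" using n by (metis add_2_eq_Suc le_Suc_ex)
    then have "(n - 1) * ((n - 1) * k) = k + n * (r * k)" by (simp add: algebra_simps)
    then show ?thesis by simp
  qed
  have "range (\<lambda>k. g ((n - 1) * k)) = range g"
    using inv eq by (auto simp: image_iff) metis
  moreover have "range (\<lambda>k. {g ((n - 1) * k), g ((n - 1) * Suc k)}) = range (\<lambda>k. {g k, g (Suc k)})"
  proof -
    have 1: "{g ((n - 1) * k), g ((n - 1) * Suc k)} = {g ((n - 1) * Suc k), g (Suc ((n - 1) * Suc k))}" for k
    proof -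
      have "Suc ((n - 1) * Suc k) = (n - 1) * k + n" using n by (cases n) auto
      then have "g ((n - 1) * k) = g (Suc ((n - 1) * Suc k))" unfolding eq by simp
      then show ?thesis by auto
    qed
    have 2: "\<exists>j. {g k, g (Suc k)} = {g ((n - 1) * Suc j), g (Suc ((n - 1) * Suc j))}" for k
    proof -
      let ?j = "(n - 1) * k + (n - 1)"
      have j: "Suc ?j = (n - 1) * k + n" using n by simp
      have "(n - 1) * Suc ?j = (n - 1) * ((n - 1) * k) + n * (n - 1)"
        unfolding j distrib_left by (simp only: mult.commute)
      then have "(n - 1) * Suc ?j mod n = k mod n" using inv[of k] by simp
      then have "g k = g ((n - 1) * Suc ?j)" "g (Suc k) = g (Suc ((n - 1) * Suc ?j))"
        unfolding eq by (metis mod_Suc_eq)+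
      then show ?thesis by metis
    qed
    show ?thesis unfolding 1 using 2 by (auto simp: image_iff)
  qed
  moreover have "(n - 1) * k mod n = (n - 1) * l mod n \<longleftrightarrow> k mod n = l mod n" for k l
    using inv by (metis mod_mult_right_eq)
  ultimately show ?thesis using g by (simp add: tour_def)
qed

lemma tour_neighbour:
  assumes g: "tour n C g" and n: "n > 0" and e: "{g k, u} \<in> C"
  shows "u = g (Suc k) \<or> u = g (k + (n - 1))"
proof -
  have eq: "g k = g l \<longleftrightarrow> k mod n = l mod n" for k l using g by (simp add: tour_def)
  obtain l where "{g k, u} = {g l, g (Suc l)}" using g e by (auto simp: tour_def)
  then consider "g k = g l" "u = g (Suc l)" | "g k = g (Suc l)" "u = g l"
    by (auto simp: doubleton_eq_iff)
  then show ?thesis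
  proof cases
    case 1
    then have "g (Suc l) = g (Suc k)" unfolding eq by (metis mod_Suc_eq)
    then show ?thesis using 1 by simp
  next
    case 2
    then have "(k + (n - 1)) mod n = (Suc l + (n - 1)) mod n"
      unfolding eq by (metis mod_add_left_eq)
    also have "Suc l + (n - 1) = l + n" using n by simp
    finally have "g (k + (n - 1)) = g l" unfolding eq by simp
    then show ?thesis using 2 by simp
  qed
qed

text \<open>After rotating and possibly reversing the walk, it begins with the in-vertex and the out-vertex
  of one node. From an out-vertex it can only continue along an arc to an in-vertex, and from there
  only to the out-vertex of the same node, since the edge joining the two is in the cycle.\<close>
lemma cyclic_perm_of_hamiltonian_cycle:
  assumes enc: "bij_betw enc X {..<N}" and N: "N \<ge> 2" and C: "hamiltonian_cycle (2 * N) C"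
    and forced: "node_edges enc X \<subseteq> C"
    and allowed: "\<And>e. e \<in> C \<Longrightarrow> e \<in> node_edges enc X \<or>
          (\<exists>x\<in>X. \<exists>y\<in>X. A x y \<and> e = {2 * enc x + 1, 2 * enc y})"
  obtains \<sigma> where "cyclic_perm X \<sigma>" "\<And>x. x \<in> X \<Longrightarrow> A x (\<sigma> x)"
    "C = node_edges enc X \<union> arc_edges enc X \<sigma>"
proof -
  let ?n = "2 * N"
  have n0: "?n > 0" using N by simp
  have X: "finite X" "card X = N"
    using enc bij_betw_finite bij_betw_same_card by fastforce+
  have enc_eq: "enc x = enc y \<longleftrightarrow> x = y" if "x \<in> X" "y \<in> X" for x y
    using enc that by (auto simp: bij_betw_def inj_on_def)
  obtain x0 where x0: "x0 \<in> X" using X N by fastforce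
  have fe: "{2 * enc x, 2 * enc x + 1} \<in> C" if "x \<in> X" for x
    using forced that by (auto simp: node_edges_def)
  obtain g where g: "tour ?n C g" "g 0 = 2 * enc x0" "g 1 = 2 * enc x0 + 1"
  proof -
    obtain f where f: "tour ?n C f" using hamiltonian_cycle_tour[OF C] .
    have "enc x0 < N" using enc x0 bij_betw_apply by fastforce
    then have "2 * enc x0 \<in> range f" using f by (simp add: tour_def)
    then obtain c where c: "f c = 2 * enc x0" by auto
    have t: "tour ?n C (\<lambda>k. f (k + c))" using f n0 by (rule tour_shift)
    have "{f (0 + c), 2 * enc x0 + 1} \<in> C" using fe[OF x0] c by simp
    then consider "2 * enc x0 + 1 = f (Suc 0 + c)" | "2 * enc x0 + 1 = f (0 + (?n - 1) + c)"
      using tour_neighbour[OF t n0, of 0] by blast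
    then show ?thesis
    proof cases
      case 1
      then show ?thesis using that[OF t] c by simp
    next
      case 2
      then show ?thesis using that[OF tour_reverse[OF t]] c N by simp
    qed
  qed
  have eq: "g k = g l \<longleftrightarrow> k mod ?n = l mod ?n" for k l using g(1) by (simp add: tour_def)
  have edge: "{g k, g (Suc k)} \<in> C" for k using g(1) by (auto simp: tour_def)
  have skip: "g (Suc (Suc k)) \<noteq> g k" for k
  proof
    assume "g (Suc (Suc k)) = g k"
    then have "?n dvd 2"
      unfolding eq by (metis add_2_eq_Suc add_diff_cancel_right' le_add2 mod_eq_dvd_iff_nat)
    then show False using N by (auto dest: dvd_imp_le)
  qed
  have arc: "\<exists>y\<in>X. A x y \<and> g (Suc (Suc k)) = 2 * enc y"
    if "g k = 2 * enc x" "g (Suc k) = 2 * enc x + 1" "x \<in> X" for k x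
  proof -
    have e: "{2 * enc x + 1, g (Suc (Suc k))} \<in> C" using edge[of "Suc k"] that by simp
    from allowed[OF e] show ?thesis
    proof
      assume "{2 * enc x + 1, g (Suc (Suc k))} \<in> node_edges enc X"
      then obtain y where "{2 * enc x + 1, g (Suc (Suc k))} = {2 * enc y, 2 * enc y + 1}"
        by (auto simp: node_edges_def)
      then have "g (Suc (Suc k)) = 2 * enc x"
        by (auto simp: doubleton_eq_iff) presburger+
      then show ?thesis using skip[of k] that by simp
    next
      assume "\<exists>x'\<in>X. \<exists>y\<in>X. A x' y \<and> {2 * enc x + 1, g (Suc (Suc k))} = {2 * enc x' + 1, 2 * enc y}"
      then obtain x' y where y: "x' \<in> X" "y \<in> X" "A x' y"
          "{2 * enc x + 1, g (Suc (Suc k))} = {2 * enc x' + 1, 2 * enc y}" by auto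
      then have "enc x = enc x'" "g (Suc (Suc k)) = 2 * enc y"
        by (auto simp: doubleton_eq_iff) presburger+
      then show ?thesis using y enc_eq that by auto
    qed
  qed
  have "\<exists>x\<in>X. g (2 * j) = 2 * enc x \<and> g (Suc (2 * j)) = 2 * enc x + 1" for j
  proof (induction j)
    case 0
    then show ?case using g x0 by auto
  next
    case (Suc j)
    then obtain x where x: "x \<in> X" "g (2 * j) = 2 * enc x" "g (Suc (2 * j)) = 2 * enc x + 1" by auto
    obtain y where y: "y \<in> X" "g (Suc (Suc (2 * j))) = 2 * enc y" using arc[OF x(2,3,1)] by auto
    have "{g (Suc (Suc (2 * j))), 2 * enc y + 1} \<in> C" using fe[OF y(1)] y by simp
    then have "2 * enc y + 1 = g (Suc (Suc (Suc (2 * j)))) \<or> 2 * enc y + 1 = g (Suc (Suc (2 * j)) + (?n - 1))"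
      by (rule tour_neighbour[OF g(1) n0])
    moreover have "g (Suc (Suc (2 * j)) + (?n - 1)) = g (Suc (2 * j))"
    proof -
      have "Suc (Suc (2 * j)) + (?n - 1) = Suc (2 * j) + ?n" using n0 by simp
      then show ?thesis unfolding eq by (simp only: mod_add_self2)
    qed
    moreover have "2 * enc y + 1 \<noteq> g (Suc (2 * j))"
      using skip[of "2 * j"] x y by auto
    ultimately show ?case using y by auto
  qed
  then obtain p where p: "\<And>j. p j \<in> X" "\<And>j. g (2 * j) = 2 * enc (p j)" "\<And>j. g (Suc (2 * j)) = 2 * enc (p j) + 1"
    by metis
  have p_arc: "A (p j) (p (Suc j))" for j
    using arc[OF p(2,3,1), of j] p(2)[of "Suc j"] enc_eq p(1) by auto
  have p_eq: "p i = p j \<longleftrightarrow> i mod N = j mod N" for i j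
  proof -
    have "p i = p j \<longleftrightarrow> g (2 * i) = g (2 * j)" using p enc_eq by auto
    also have "\<dots> \<longleftrightarrow> i mod N = j mod N" unfolding eq by simp
    finally show ?thesis .
  qed
  have p_range: "range p = X"
  proof
    show "X \<subseteq> range p"
    proof
      fix x assume x: "x \<in> X"
      then have "enc x < N" using enc bij_betw_apply by fastforce
      then have "2 * enc x \<in> range g" using g(1) by (simp add: tour_def)
      then obtain k where k: "2 * enc x = g k" by auto
      have "even k"
      proof (rule ccontr)
        assume "odd k"
        then obtain j where "k = Suc (2 * j)" by (auto elim: oddE)
        then have "2 * enc x = 2 * enc (p j) + 1" using k p by simp
        then show False by presburger
      qed
      then obtain j where "k = 2 * j" by (auto elim: evenE)
      then have "x = p j" using k p x enc_eq by simp
      then show "x \<in> range p" by simp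
    qed
  qed (use p in auto)
  define \<sigma> where "\<sigma> x = p (Suc (SOME j. p j = x))" for x
  have \<sigma>: "\<sigma> (p j) = p (Suc j)" for j
  proof -
    have "p (SOME i. p i = p j) = p j" by (rule someI) (rule refl)
    then show ?thesis unfolding \<sigma>_def p_eq by (metis mod_Suc_eq)
  qed
  have surj: "\<sigma> ` X = X"
  proof
    show "\<sigma> ` X \<subseteq> X" unfolding p_range[symmetric] using \<sigma> by auto
    have "p j = \<sigma> (p (j + (N - 1)))" for j
      unfolding \<sigma> p_eq using N by simp
    then show "X \<subseteq> \<sigma> ` X" unfolding p_range[symmetric] by blast
  qed
  have "cyclic_perm X \<sigma>"
    unfolding cyclic_perm_def
  proof (intro conjI allI impI)
    show "bij_betw \<sigma> X X"
      using surj X(1) by (simp add: bij_betw_def eq_card_imp_inj_on)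
    fix Y assume Y: "Y \<subseteq> X" "Y \<noteq> {}" "\<sigma> ` Y \<subseteq> Y"
    then obtain i where i: "p i \<in> Y" using p_range by blast
    have "p (i + k) \<in> Y" for k
      by (induction k) (use i \<sigma> Y in \<open>force+\<close>)
    moreover have "p j = p (i + (j + (N - 1) * i))" for j
    proof -
      have *: "i + (j + (N - 1) * i) = j + N * i" using N by (cases N) auto
      show ?thesis unfolding p_eq * by simp
    qed
    ultimately have "p j \<in> Y" for j by metis
    then show "Y = X" using Y p_range by blast
  qed
  moreover have "A x (\<sigma> x)" if "x \<in> X" for x
    using that p_arc \<sigma> unfolding p_range[symmetric] by auto
  moreover have "C = node_edges enc X \<union> arc_edges enc X \<sigma>"
  proof -
    have "(UNIV :: nat set) = range (\<lambda>j. 2 * j) \<union> range (\<lambda>j. Suc (2 * j))"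
      by (auto elim!: evenE oddE simp: image_iff) presburger
    then have "C = (\<lambda>k. {g k, g (Suc k)}) ` (range (\<lambda>j. 2 * j) \<union> range (\<lambda>j. Suc (2 * j)))"
      using g(1) by (simp add: tour_def)
    also have "\<dots> = range (\<lambda>j. {2 * enc (p j), 2 * enc (p j) + 1}) \<union> range (\<lambda>j. {2 * enc (p j) + 1, 2 * enc (\<sigma> (p j))})"
      unfolding image_Un image_image using p(2)[of "Suc _"] p \<sigma> by simp
    also have "\<dots> = node_edges enc X \<union> arc_edges enc X \<sigma>"
      unfolding node_edges_def arc_edges_def p_range[symmetric] image_image ..
    finally show ?thesis .
  qed
  ultimately show ?thesis using that by blast
qed

section \<open>A digraph whose Hamiltonian cycles encode a family of sets\<close>

lemma cyclic_induct_up: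
  fixes k0 :: nat
  assumes "Q k0" "k0 < D" "k < D" and rot: "\<And>k. k < D \<Longrightarrow> Q k \<Longrightarrow> Q (Suc k mod D)"
  shows "Q k"
proof -
  have up: "Q j" if "Q i" "i \<le> j" "j < D" for i j
    using that(2,1,3)
  proof (induction rule: dec_induct)
    case (step n)
    then show ?case using rot[of n] by simp
  qed
  have "Q (D - 1)" using up[OF assms(1)] assms(2,3) by simp
  then have "Q 0" using rot[of "D - 1"] assms(2,3) by simp
  then show ?thesis using up[of 0 k] assms(2,3) by simp
qed

lemma cyclic_induct_down:
  fixes k0 :: nat
  assumes "Q k0" "k0 < D" "k < D" and rot: "\<And>k. k < D \<Longrightarrow> Q (Suc k mod D) \<Longrightarrow> Q k"
  shows "Q k"
proof -
  have down: "Q i" if "Q j" "i \<le> j" "j < D" for i j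
    using that(2,1,3)
  proof (induction rule: inc_induct)
    case (step n)
    then show ?case using rot[of n] by simp
  qed
  have "Q 0" using down[OF assms(1)] assms(2,3) by simp
  then have "Q (D - 1)" using rot[of "D - 1"] assms(2,3) by simp
  then show ?thesis using down[of "D - 1" k] assms(2,3) by simp
qed

text \<open>Suppose a bijection takes at each point the value of one of two injections. If \<open>f x = g y\<close>, this
  common value would be attained twice if \<open>f\<close> were selected at \<open>x\<close> and \<open>g\<close> at \<open>y\<close>, and not at all
  if it were the other way round.\<close>
lemma selection_constant_on_links:
  assumes h: "bij_betw h X X" and f: "inj_on f X" and g: "inj_on g X"
    and sel: "\<And>x. x \<in> X \<Longrightarrow> h x = (if B x then f x else g x)"
    and x: "x \<in> X" and y: "y \<in> X" and eq: "f x = g y" and fX: "f x \<in> X"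
  shows "B x = B y"
proof (cases "B x")
  case True
  show ?thesis
  proof (rule ccontr)
    assume "B x \<noteq> B y"
    then have "h x = h y" using sel x y eq True by simp
    then have "x = y" using h x y by (auto simp: bij_betw_def inj_on_def)
    then show False using \<open>B x \<noteq> B y\<close> by simp
  qed
next
  case False
  have "f x \<in> h ` X" using h fX by (simp add: bij_betw_def)
  then obtain w where w: "w \<in> X" "h w = f x" by force
  have "\<not> B w"
  proof
    assume "B w"
    then have "f w = f x" using sel w by simp
    then have "w = x" using f w x by (auto simp: inj_on_def)
    then show False using False \<open>B w\<close> by simp
  qed
  then have "g w = g y" using sel w eq by simp
  then have "w = y" using g w y by (auto simp: inj_on_def)
  then show ?thesis using False \<open>\<not> B w\<close> by simp
qed

text \<open>The sets \<open>T 0, \<dots>, T (L - 1)\<close>, possibly with repetitions, are the subsets of \<open>{..<D}\<close> to be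
  excluded. Allowing repetitions makes the number of nodes independent of the number of
  excluded sets.\<close>
locale clause_gadget =
  fixes D L :: nat and T :: "nat \<Rightarrow> nat set"
  assumes D: "D \<ge> 2" and L: "L \<ge> 1"
begin

text \<open>Pairs of row and column. The rows \<open>2 * r\<close> and \<open>2 * r + 1\<close> belong to \<open>T r\<close>, and \<open>2 * L\<close> is the main row.\<close>
definition nodes :: "(nat \<times> nat) set" where
  "nodes = {..2 * L} \<times> {..<D}"

definition enc :: "nat \<times> nat \<Rightarrow> nat" where
  "enc = (\<lambda>(x, i). x * D + i)"

text \<open>Whether the bit \<open>s\<close> of column \<open>i\<close> distinguishes the chosen set from \<open>T r\<close>.\<close>
definition active :: "nat \<Rightarrow> nat \<Rightarrow> bool \<Rightarrow> bool" where
  "active r i s \<longleftrightarrow> s \<noteq> (i \<in> T r)"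

text \<open>The value \<open>L\<close>, standing for the main row, closes the chain of active pairs of rows.\<close>
definition next_active :: "nat \<Rightarrow> bool \<Rightarrow> nat \<Rightarrow> nat" where
  "next_active i s k = (LEAST r. k \<le> r \<and> (r = L \<or> active r i s))"

text \<open>The permutation of column \<open>i\<close> for the bit \<open>s\<close>: a cycle through the main row and all active pairs
  of rows, and the identity on the other rows.\<close>
definition hop :: "nat \<Rightarrow> bool \<Rightarrow> nat \<Rightarrow> nat" where
  "hop i s x = (if x = 2 * L then 2 * next_active i s 0
     else if \<not> active (x div 2) i s then x
     else if even x then Suc x else 2 * next_active i s (Suc (x div 2)))"

text \<open>The horizontal move: one column up in even rows and one column down in odd ones. The
  opposite directions within a pair of rows are what makes the rows merge into one cycle.\<close>
definition turn :: "nat \<times> nat \<Rightarrow> nat \<times> nat" where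
  "turn = (\<lambda>(x, i). (x, if even x then Suc i mod D else (i + (D - 1)) mod D))"

definition succ :: "bool \<Rightarrow> nat \<times> nat \<Rightarrow> nat \<times> nat" where
  "succ s = (\<lambda>(x, i). turn (hop i s x, i))"

definition succ_at :: "nat set \<Rightarrow> nat \<times> nat \<Rightarrow> nat \<times> nat" where
  "succ_at a v = succ (snd v \<in> a) v"

lemma enc_bij: "bij_betw enc nodes {..<(2 * L + 1) * D}"
proof -
  have "inj_on enc nodes"
  proof (rule inj_onI)
    fix v w assume vw: "v \<in> nodes" "w \<in> nodes" and eq: "enc v = enc w"
    have "enc u div D = fst u" "enc u mod D = snd u" if "u \<in> nodes" for u
      using that by (auto simp: nodes_def enc_def)
    then show "v = w" using vw eq by (metis prod.collapse)
  qed
  moreover have "enc ` nodes \<subseteq> {..<(2 * L + 1) * D}"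
  proof clarsimp
    fix x i assume "(x, i) \<in> nodes"
    then have "i < D" "x * D \<le> 2 * L * D" by (auto simp: nodes_def)
    then show "enc (x, i) < D + 2 * L * D" unfolding enc_def prod.case by linarith
  qed
  moreover have "card nodes = card {..<(2 * L + 1) * D}" by (simp add: nodes_def)
  ultimately show ?thesis
    by (simp add: bij_betw_def card_image card_subset_eq)
qed

lemma finite_nodes: "finite nodes" by (simp add: nodes_def)

lemma next_active_props:
  assumes "k \<le> L"
  shows "k \<le> next_active i s k" "next_active i s k \<le> L"
    "next_active i s k = L \<or> active (next_active i s k) i s"
proof -
  have *: "k \<le> L \<and> (L = L \<or> active L i s)" using assms by simp
  show "k \<le> next_active i s k" "next_active i s k = L \<or> active (next_active i s k) i s"
    using LeastI[of "\<lambda>r. k \<le> r \<and> (r = L \<or> active r i s)", OF *] by (auto simp: next_active_def)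
  show "next_active i s k \<le> L"
    unfolding next_active_def using * by (rule Least_le)
qed

lemma hop_le: "x \<le> 2 * L \<Longrightarrow> hop i s x \<le> 2 * L"
  using next_active_props(2)[of 0 i s] next_active_props(2)[of "Suc (x div 2)" i s]
  by (auto simp: hop_def)

text \<open>The main row or an active row \<open>2 * r\<close> is entered from the last active pair before it, or from the
  main row if there is none.\<close>
lemma hop_predecessor:
  assumes "r \<le> L" "r = L \<or> active r i s"
  obtains x where "x = 2 * L \<or> (\<exists>p<r. x = Suc (2 * p))" "hop i s x = 2 * r"
proof (cases "\<exists>p<r. active p i s")
  case False
  have "next_active i s 0 = r"
    unfolding next_active_def
  proof (rule Least_equality)
    fix y assume "0 \<le> y \<and> (y = L \<or> active y i s)"
    then show "r \<le> y" using assms False by (meson leI)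
  qed (use assms in auto)
  then show ?thesis using that[of "2 * L"] by (simp add: hop_def)
next
  case True
  define p where "p = Max {p. p < r \<and> active p i s}"
  have "p \<in> {p. p < r \<and> active p i s}"
    unfolding p_def using True by (intro Max_in) auto
  then have p: "p < r" "active p i s" by auto
  have max: "q \<le> p" if "q < r" "active q i s" for q
    unfolding p_def using that by (intro Max_ge) auto
  have "next_active i s (Suc p) = r"
    unfolding next_active_def
  proof (rule Least_equality)
    fix y assume "Suc p \<le> y \<and> (y = L \<or> active y i s)"
    then show "r \<le> y" using assms max[of y] by (meson leI not_less_eq_eq)
  qed (use assms p in auto)
  moreover have "Suc (2 * p) \<noteq> 2 * L" by presburger
  ultimately have "hop i s (Suc (2 * p)) = 2 * r" using p by (simp add: hop_def)
  then show ?thesis using that[of "Suc (2 * p)"] p by blast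
qed

lemma hop_bij: "bij_betw (hop i s) {..2 * L} {..2 * L}"
proof -
  have "{..2 * L} \<subseteq> hop i s ` {..2 * L}"
  proof
    fix y assume y: "y \<in> {..2 * L}"
    show "y \<in> hop i s ` {..2 * L}"
    proof (cases "y = 2 * L \<or> active (y div 2) i s")
      case False
      then have "hop i s y = y" by (simp add: hop_def)
      then show ?thesis using y by (metis imageI)
    next
      case act: True
      show ?thesis
      proof (cases "even y")
        case True
        then obtain r where r: "y = 2 * r" by (auto elim: evenE)
        then obtain x where "x = 2 * L \<or> (\<exists>p<r. x = Suc (2 * p))" "hop i s x = 2 * r"
          using hop_predecessor[of r i s] y act by auto
        then show ?thesis using y r by (intro image_eqI[of _ _ x]) auto
      next
        case False
        then obtain r where r: "y = Suc (2 * r)" by (auto elim: oddE)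
        have "y \<noteq> 2 * L" using False by auto
        then have "active r i s" "r < L" using act y r by auto
        then have "hop i s (2 * r) = y" using r by (simp add: hop_def)
        then show ?thesis using y r by (intro image_eqI[of _ _ "2 * r"]) auto
      qed
    qed
  qed
  then have "hop i s ` {..2 * L} = {..2 * L}" using hop_le by auto
  then show ?thesis by (simp add: bij_betw_def eq_card_imp_inj_on)
qed

lemma rotate_back:
  assumes "i < D"
  shows "Suc ((i + (D - 1)) mod D) mod D = i" "(Suc i mod D + (D - 1)) mod D = i"
proof -
  have *: "Suc (i + (D - 1)) = i + D" "Suc i + (D - 1) = i + D" using D by simp_all
  show "Suc ((i + (D - 1)) mod D) mod D = i" "(Suc i mod D + (D - 1)) mod D = i"
    unfolding mod_Suc_eq mod_add_left_eq * using assms by simp_all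
qed

lemma turn_bij: "bij_betw turn nodes nodes"
proof -
  have "nodes \<subseteq> turn ` nodes"
  proof
    fix v assume "v \<in> nodes"
    then obtain x i where v: "v = (x, i)" "x \<le> 2 * L" "i < D" by (auto simp: nodes_def)
    let ?i = "if even x then (i + (D - 1)) mod D else Suc i mod D"
    have "turn (x, ?i) = v" using rotate_back[OF v(3)] v(1) by (simp add: turn_def)
    moreover have "(x, ?i) \<in> nodes" using v D by (simp add: nodes_def)
    ultimately show "v \<in> turn ` nodes" by (metis imageI)
  qed
  moreover have "turn ` nodes \<subseteq> nodes"
    using D by (auto simp: nodes_def turn_def)
  ultimately show ?thesis
    using finite_nodes by (simp add: bij_betw_def eq_card_imp_inj_on subset_antisym)
qed

lemma column_hop_bij: "bij_betw (\<lambda>(x, i). (hop i (b i) x, i)) nodes nodes"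
proof -
  have "nodes \<subseteq> (\<lambda>(x, i). (hop i (b i) x, i)) ` nodes"
  proof
    fix v assume "v \<in> nodes"
    then obtain y i where v: "v = (y, i)" "y \<le> 2 * L" "i < D" by (auto simp: nodes_def)
    then have "y \<in> hop i (b i) ` {..2 * L}" using hop_bij by (simp add: bij_betw_def)
    then obtain x where "x \<le> 2 * L" "y = hop i (b i) x" by auto
    then show "v \<in> (\<lambda>(x, i). (hop i (b i) x, i)) ` nodes"
      using v by (intro image_eqI[of _ _ "(x, i)"]) (auto simp: nodes_def)
  qed
  moreover have "(\<lambda>(x, i). (hop i (b i) x, i)) ` nodes \<subseteq> nodes"
    using hop_le by (auto simp: nodes_def)
  ultimately show ?thesis
    using finite_nodes by (simp add: bij_betw_def eq_card_imp_inj_on subset_antisym)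
qed

lemma succ_bij: "bij_betw (succ s) nodes nodes"
  using bij_betw_trans[OF column_hop_bij turn_bij, of "\<lambda>_. s"]
  by (rule bij_betw_cong[THEN iffD1, rotated]) (auto simp: succ_def)

lemma succ_at_bij: "bij_betw (succ_at a) nodes nodes"
  using bij_betw_trans[OF column_hop_bij turn_bij, of "\<lambda>i. i \<in> a"]
  by (rule bij_betw_cong[THEN iffD1, rotated]) (auto simp: succ_at_def succ_def)

lemma succ_neq_self: "v \<in> nodes \<Longrightarrow> succ s v \<noteq> v"
proof -
  have "Suc i mod D \<noteq> i" "(i + (D - 1)) mod D \<noteq> i" if "i < D" for i
  proof -
    show "Suc i mod D \<noteq> i" using that D by (cases "Suc i = D") auto
    show "(i + (D - 1)) mod D \<noteq> i"
    proof (cases i)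
      case (Suc j)
      then have "i + (D - 1) = j + D" using D by simp
      then show ?thesis using that Suc by simp
    qed (use D in simp)
  qed
  then show "v \<in> nodes \<Longrightarrow> succ s v \<noteq> v"
    by (auto simp: nodes_def succ_def turn_def split: if_splits)
qed

lemma succ_row_0_neq: "succ s (0, i) \<noteq> succ (\<not> s) (0, i)"
  using L by (auto simp: succ_def turn_def hop_def active_def)

text \<open>For each \<open>r\<close> exactly one bit makes column \<open>i\<close> active. That bit sends row \<open>2 * r\<close> to row \<open>2 * r + 1\<close>,
  where the other bit stays, so that both rows select the same bit. Likewise row \<open>2 * r\<close> selects
  the same bit as the row from which it is entered, which belongs to an earlier pair or is the main
  row. By induction over \<open>r\<close> a whole column selects the bit of its main row.\<close>
lemma bijective_selection_is_uniform:
  assumes \<sigma>: "bij_betw \<sigma> nodes nodes" and sel: "\<And>v. v \<in> nodes \<Longrightarrow> \<exists>s. \<sigma> v = succ s v"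
  obtains a where "a \<subseteq> {..<D}" "\<And>v. v \<in> nodes \<Longrightarrow> \<sigma> v = succ_at a v"
proof -
  obtain B where B: "\<And>v. v \<in> nodes \<Longrightarrow> \<sigma> v = succ (B v) v" using sel by metis
  have link: "B v = B w" if "v \<in> nodes" "w \<in> nodes" "succ s v = succ (\<not> s) w" for s v w
  proof -
    have *: "B v = B w" if "v \<in> nodes" "w \<in> nodes" "succ True v = succ False w" for v w
    proof (rule selection_constant_on_links[OF \<sigma>])
      show "inj_on (succ True) nodes" "inj_on (succ False) nodes"
        using succ_bij by (auto simp: bij_betw_def)
      show "succ True v \<in> nodes" using succ_bij that by (auto simp: bij_betw_def)
    qed (use that B in auto)
    show ?thesis using *[of v w] *[of w v] that by (cases s) auto
  qed
  have col: "B (x, i) = B (2 * L, i)" if "x \<le> 2 * L" "i < D" for x i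
  proof -
    have main: "B (2 * r, i) = B (2 * L, i) \<and> B (Suc (2 * r), i) = B (2 * L, i)" if "r < L" for r
      using that
    proof (induction r rule: less_induct)
      case (less r)
      define s where "s = (i \<notin> T r)"
      have s: "active r i s" "\<not> active r i (\<not> s)" by (auto simp: active_def s_def)
      have "2 * r \<noteq> 2 * L" "Suc (2 * r) \<noteq> 2 * L" using less.prems by presburger+
      then have h: "hop i s (2 * r) = Suc (2 * r)" "hop i (\<not> s) (2 * r) = 2 * r"
          "hop i (\<not> s) (Suc (2 * r)) = Suc (2 * r)"
        using s by (simp_all add: hop_def)
      have "B (2 * r, i) = B (Suc (2 * r), i)"
        using less.prems \<open>i < D\<close> h by (intro link[of _ _ s]) (auto simp: nodes_def succ_def)
      moreover obtain x where x: "x = 2 * L \<or> (\<exists>p<r. x = Suc (2 * p))" "hop i s x = 2 * r"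
        using hop_predecessor[of r i s] less.prems s by auto
      then have "B (x, i) = B (2 * r, i)"
        using less.prems \<open>i < D\<close> h by (intro link[of _ _ s]) (auto simp: nodes_def succ_def)
      moreover have "B (x, i) = B (2 * L, i)" using x(1) less by auto
      ultimately show ?case by simp
    qed
    show ?thesis
    proof (cases "even x")
      case True
      then obtain r where "x = 2 * r" by (auto elim: evenE)
      then show ?thesis using main[of r] that by (cases "r = L") auto
    next
      case False
      then obtain r where "x = Suc (2 * r)" by (auto elim: oddE)
      then show ?thesis using main[of r] that by auto
    qed
  qed
  define a where "a = {i. i < D \<and> B (2 * L, i)}"
  have "\<sigma> v = succ_at a v" if v_node: "v \<in> nodes" for v
  proof -
    obtain x i where v: "v = (x, i)" "x \<le> 2 * L" "i < D" using v_node by (auto simp: nodes_def)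
    then have "B v = (i \<in> a)" using col[of x i] by (simp add: a_def)
    then show ?thesis using B[OF v_node] v by (simp add: succ_at_def)
  qed
  then show ?thesis using that[of a] by (auto simp: a_def)
qed

text \<open>For an invariant set \<open>Y\<close>, membership in \<open>Y\<close> is unchanged by the permutation, and the claim is
  that it is constant. The key fact \<open>pair\<close> compares row \<open>2 * r\<close> at column \<open>k + 1\<close>
  with row \<open>2 * r + 1\<close> at column \<open>k\<close>: if column \<open>k + 1\<close> is active this is one step of the
  permutation, otherwise each of the two sides moves on by one column, so that the statement is
  passed backwards from an active column around the cycle. Hence an excursion from column \<open>k\<close> through an
  active pair returns to column \<open>k\<close>, and following the chain of active pairs links neighbouring
  columns of the main row.\<close>
lemma cyclic_perm_succ_at:
  assumes a: "\<And>r. r < L \<Longrightarrow> \<exists>i<D. active r i (i \<in> a)"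
  shows "cyclic_perm nodes (succ_at a)"
  unfolding cyclic_perm_def
proof (intro conjI allI impI)
  show "bij_betw (succ_at a) nodes nodes" by (rule succ_at_bij)
  fix Y assume Y: "Y \<subseteq> nodes" "Y \<noteq> {}" "succ_at a ` Y \<subseteq> Y"
  have inj: "inj_on (succ_at a) nodes" using succ_at_bij by (simp add: bij_betw_def)
  have "card (succ_at a ` Y) = card Y"
    using inj Y by (intro card_image) (rule inj_on_subset)
  then have img: "succ_at a ` Y = Y"
    using Y finite_nodes by (intro card_subset_eq) (auto dest: finite_subset)
  have orbit: "v \<in> Y \<longleftrightarrow> succ_at a v \<in> Y" if "v \<in> nodes" for v
  proof
    assume "succ_at a v \<in> Y"
    then obtain w where "w \<in> Y" "succ_at a v = succ_at a w" using img by (metis imageE)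
    then show "v \<in> Y" using inj_onD[OF inj, of v w] that Y(1) by blast
  qed (use Y(3) in blast)
  let ?act = "\<lambda>r i. active r i (i \<in> a)"
  have orb: "(x, i) \<in> Y \<longleftrightarrow> turn (hop i (i \<in> a) x, i) \<in> Y" if "x \<le> 2 * L" "i < D" for x i
    using orbit[of "(x, i)"] that by (simp add: nodes_def succ_at_def succ_def)
  have neq: "2 * r \<noteq> 2 * L" "Suc (2 * r) \<noteq> 2 * L" "Suc (2 * r) div 2 = r" if "r < L" for r
    using that by presburger+
  note prev = rotate_back(2)
  have inactive_even: "(2 * r, i) \<in> Y \<longleftrightarrow> (2 * r, Suc i mod D) \<in> Y"
    if "r < L" "i < D" "\<not> ?act r i" for r i
    using orb[of "2 * r" i] that by (simp add: hop_def turn_def)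
  have inactive_odd: "(Suc (2 * r), i) \<in> Y \<longleftrightarrow> (Suc (2 * r), (i + (D - 1)) mod D) \<in> Y"
    if "r < L" "i < D" "\<not> ?act r i" for r i
    using orb[of "Suc (2 * r)" i] that neq[OF that(1)] by (simp add: hop_def turn_def)
  have active_even: "(2 * r, i) \<in> Y \<longleftrightarrow> (Suc (2 * r), (i + (D - 1)) mod D) \<in> Y"
    if "r < L" "i < D" "?act r i" for r i
    using orb[of "2 * r" i] that by (simp add: hop_def turn_def)
  have active_odd: "(Suc (2 * r), i) \<in> Y \<longleftrightarrow> (2 * next_active i (i \<in> a) (Suc r), Suc i mod D) \<in> Y"
    if "r < L" "i < D" "?act r i" for r i
    using orb[of "Suc (2 * r)" i] that neq[OF that(1)] by (simp add: hop_def turn_def)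
  have main: "(2 * L, i) \<in> Y \<longleftrightarrow> (2 * next_active i (i \<in> a) 0, Suc i mod D) \<in> Y"
    if "i < D" for i
    using orb[of "2 * L" i] that by (simp add: hop_def turn_def)
  have pair: "(2 * r, Suc k mod D) \<in> Y \<longleftrightarrow> (Suc (2 * r), k) \<in> Y" if r: "r < L" and "k < D" for r k
  proof -
    obtain i where i: "i < D" "?act r i" using a[OF r] by auto
    let ?k = "(i + (D - 1)) mod D"
    have "?k < D" using D by simp
    have base: "(2 * r, Suc ?k mod D) \<in> Y \<longleftrightarrow> (Suc (2 * r), ?k) \<in> Y"
    proof -
      have "Suc ?k mod D = i" using i by (intro rotate_back)
      then show ?thesis using active_even[OF r i] by simp
    qed
    show ?thesis
      using base \<open>?k < D\<close> \<open>k < D\<close>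
    proof (rule cyclic_induct_down[where Q = "\<lambda>k. (2 * r, Suc k mod D) \<in> Y \<longleftrightarrow> (Suc (2 * r), k) \<in> Y"])
      fix k assume k: "k < D"
        and IH: "(2 * r, Suc (Suc k mod D) mod D) \<in> Y \<longleftrightarrow> (Suc (2 * r), Suc k mod D) \<in> Y"
      have "Suc k mod D < D" using D by simp
      then show "(2 * r, Suc k mod D) \<in> Y \<longleftrightarrow> (Suc (2 * r), k) \<in> Y"
        using active_even[OF r, of "Suc k mod D"] inactive_even[OF r, of "Suc k mod D"]
          inactive_odd[OF r, of "Suc k mod D"] IH prev[OF k]
        by (cases "?act r (Suc k mod D)") simp_all
    qed
  qed
  have chain: "(2 * r, Suc k mod D) \<in> Y \<longleftrightarrow> (2 * L, Suc k mod D) \<in> Y"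
    if "r \<le> L" "r = L \<or> ?act r k" "k < D" for r k
    using that
  proof (induction "L - r" arbitrary: r rule: less_induct)
    case less
    show ?case
    proof (cases "r = L")
      case False
      then have r: "r < L" "?act r k" using less.prems by auto
      let ?r = "next_active k (k \<in> a) (Suc r)"
      have "Suc r \<le> ?r" "?r \<le> L" "?r = L \<or> ?act ?r k" using next_active_props[of "Suc r"] r by auto
      then have "(2 * ?r, Suc k mod D) \<in> Y \<longleftrightarrow> (2 * L, Suc k mod D) \<in> Y"
        using r less.prems by (intro less.hyps) auto
      then show ?thesis using pair active_odd r less.prems by simp
    qed simp
  qed
  have main_step: "(2 * L, k) \<in> Y \<longleftrightarrow> (2 * L, Suc k mod D) \<in> Y" if "k < D" for k
    using main[OF that] chain[OF next_active_props(2,3)[OF le0] that] by (rule trans)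
  have main_all: "(2 * L, k) \<in> Y \<longleftrightarrow> (2 * L, 0) \<in> Y" if "k < D" for k
  proof (rule cyclic_induct_up[where Q = "\<lambda>k. (2 * L, k) \<in> Y \<longleftrightarrow> (2 * L, 0) \<in> Y" and ?k0.0 = 0])
    fix k assume "k < D" "(2 * L, k) \<in> Y \<longleftrightarrow> (2 * L, 0) \<in> Y"
    then show "(2 * L, Suc k mod D) \<in> Y \<longleftrightarrow> (2 * L, 0) \<in> Y" using main_step[of k] by blast
  qed (use that in auto)
  have even_all: "(2 * r, k) \<in> Y \<longleftrightarrow> (2 * L, 0) \<in> Y" if r: "r < L" and "k < D" for r k
  proof -
    have act: "(2 * r, Suc i mod D) \<in> Y \<longleftrightarrow> (2 * L, 0) \<in> Y" if "i < D" "?act r i" for i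
      using chain[of r i] main_all[of "Suc i mod D"] that r D by (simp only: less_imp_le mod_less_divisor) simp
    obtain i where i: "i < D" "?act r i" using a[OF r] by auto
    have "Suc i mod D < D" using D by simp
    from act[OF i] this \<open>k < D\<close> show ?thesis
    proof (rule cyclic_induct_up[where Q = "\<lambda>k. (2 * r, k) \<in> Y \<longleftrightarrow> (2 * L, 0) \<in> Y"])
      fix k assume "k < D" "(2 * r, k) \<in> Y \<longleftrightarrow> (2 * L, 0) \<in> Y"
      then show "(2 * r, Suc k mod D) \<in> Y \<longleftrightarrow> (2 * L, 0) \<in> Y"
        using act[of k] inactive_even[OF r, of k] by blast
    qed
  qed
  have all: "v \<in> Y \<longleftrightarrow> (2 * L, 0) \<in> Y" if v_node: "v \<in> nodes" for v
  proof -
    obtain x k where v: "v = (x, k)" "x \<le> 2 * L" "k < D" using v_node by (auto simp: nodes_def)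
    show ?thesis
    proof (cases "even x")
      case True
      then obtain r where "x = 2 * r" by (auto elim: evenE)
      then show ?thesis using v even_all[of r k] main_all[of k] by (cases "r = L") auto
    next
      case False
      then obtain r where r: "x = Suc (2 * r)" by (auto elim: oddE)
      then have "r < L" using v by auto
      then show ?thesis using v r pair[of r k] even_all[of r "Suc k mod D"] D by simp
    qed
  qed
  then show "Y = nodes" using Y by blast
qed

lemma not_cyclic_perm_succ_at:
  assumes "r < L" and a: "\<And>i. i < D \<Longrightarrow> \<not> active r i (i \<in> a)"
  shows "\<not> cyclic_perm nodes (succ_at a)"
proof
  assume cyc: "cyclic_perm nodes (succ_at a)"
  let ?Y = "{2 * r} \<times> {..<D}"
  have "succ_at a ` ?Y \<subseteq> ?Y"
    using assms D by (auto simp: succ_at_def succ_def turn_def hop_def)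
  moreover have "?Y \<subseteq> nodes" "?Y \<noteq> {}" using assms(1) D by (auto simp: nodes_def lessThan_empty_iff)
  ultimately have "?Y = nodes" using cyc by (simp add: cyclic_perm_def)
  moreover have "(2 * L, 0) \<in> nodes" using D by (simp add: nodes_def)
  ultimately have "(2 * L, 0) \<in> ?Y" by simp
  then show False using assms by simp
qed

lemma cyclic_perm_succ_at_iff:
  assumes "a \<subseteq> {..<D}" "\<And>r. r < L \<Longrightarrow> T r \<subseteq> {..<D}"
  shows "cyclic_perm nodes (succ_at a) \<longleftrightarrow> a \<notin> T ` {..<L}"
proof -
  have "(\<exists>i<D. active r i (i \<in> a)) \<longleftrightarrow> a \<noteq> T r" if "r < L" for r
    using assms that by (auto simp: active_def)
  then show ?thesis
    using cyclic_perm_succ_at[of a] not_cyclic_perm_succ_at[of _ a] by blast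
qed

text \<open>Depends on \<open>D\<close> and \<open>L\<close> only, and not on the sets \<open>T r\<close>.\<close>
definition "vertex_count = 2 * ((2 * L + 1) * D)"

definition "cycle_at a = node_edges enc nodes \<union> arc_edges enc nodes (succ_at a)"

definition "allowed_edges = node_edges enc nodes \<union>
  {{2 * enc v + 1, 2 * enc (succ s v)} |v s. v \<in> nodes}"

lemma two_le_node_count: "(2 * L + 1) * D \<ge> 2"
  using D by (simp add: trans_le_add1)

lemma hamiltonian_cycles_between_iff:
  assumes "\<And>r. r < L \<Longrightarrow> T r \<subseteq> {..<D}"
  shows "hamiltonian_cycle vertex_count C \<and> node_edges enc nodes \<subseteq> C \<and> C \<subseteq> allowed_edges
     \<longleftrightarrow> (\<exists>a. a \<subseteq> {..<D} \<and> a \<notin> T ` {..<L} \<and> C = cycle_at a)"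
proof
  assume C: "hamiltonian_cycle vertex_count C \<and> node_edges enc nodes \<subseteq> C \<and> C \<subseteq> allowed_edges"
  let ?A = "\<lambda>v w. \<exists>s. w = succ s v"
  have "e \<in> node_edges enc nodes \<or> (\<exists>v\<in>nodes. \<exists>w\<in>nodes. ?A v w \<and> e = {2 * enc v + 1, 2 * enc w})"
    if "e \<in> C" for e
  proof -
    have "e \<in> node_edges enc nodes \<or> (\<exists>v s. v \<in> nodes \<and> e = {2 * enc v + 1, 2 * enc (succ s v)})"
      using C that unfolding allowed_edges_def by blast
    moreover have "succ s v \<in> nodes" if "v \<in> nodes" for s v
      using succ_bij that by (rule bij_betw_apply)
    ultimately show ?thesis by blast
  qed
  then obtain \<sigma> where \<sigma>: "cyclic_perm nodes \<sigma>" "\<And>v. v \<in> nodes \<Longrightarrow> \<exists>s. \<sigma> v = succ s v"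
      "C = node_edges enc nodes \<union> arc_edges enc nodes \<sigma>"
    using cyclic_perm_of_hamiltonian_cycle[OF enc_bij two_le_node_count, of C ?A] C unfolding vertex_count_def by blast
  obtain a where a: "a \<subseteq> {..<D}" "\<And>v. v \<in> nodes \<Longrightarrow> \<sigma> v = succ_at a v"
    using bijective_selection_is_uniform[of \<sigma>] \<sigma>(1,2) unfolding cyclic_perm_def by blast
  have "cyclic_perm nodes (succ_at a)"
  proof -
    have "\<sigma> ` Y = succ_at a ` Y" if "Y \<subseteq> nodes" for Y
      using a(2) that by (intro image_cong) auto
    then show ?thesis
      using \<sigma>(1) succ_at_bij unfolding cyclic_perm_def by auto
  qed
  moreover have "arc_edges enc nodes \<sigma> = arc_edges enc nodes (succ_at a)"
    unfolding arc_edges_def using a(2) by (intro image_cong) auto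
  ultimately show "\<exists>a. a \<subseteq> {..<D} \<and> a \<notin> T ` {..<L} \<and> C = cycle_at a"
    using a(1) \<sigma>(3) cyclic_perm_succ_at_iff[OF a(1) assms] by (auto simp: cycle_at_def)
next
  assume "\<exists>a. a \<subseteq> {..<D} \<and> a \<notin> T ` {..<L} \<and> C = cycle_at a"
  then obtain a where a: "a \<subseteq> {..<D}" "a \<notin> T ` {..<L}" "C = cycle_at a" by auto
  then have "cyclic_perm nodes (succ_at a)" using cyclic_perm_succ_at_iff assms by simp
  then have "hamiltonian_cycle vertex_count C"
    unfolding a(3) cycle_at_def vertex_count_def by (rule hamiltonian_cycle_of_cyclic_perm[OF enc_bij two_le_node_count])
  moreover have "arc_edges enc nodes (succ_at a) \<subseteq> allowed_edges"
    by (auto simp: arc_edges_def allowed_edges_def succ_at_def)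
  ultimately show "hamiltonian_cycle vertex_count C \<and> node_edges enc nodes \<subseteq> C \<and> C \<subseteq> allowed_edges"
    using a by (auto simp: cycle_at_def allowed_edges_def)
qed

end

section \<open>Polytopes of 0-1 vectors as faces of the travelling salesman polytope\<close>

lemma lookup_adjacency_matrix:
  "lookup (adjacency_matrix n C) (i, j) = (if i < n \<and> j < n \<and> {i, j} \<in> C then 1 else 0)"
proof -
  have "lookup (adjacency_matrix n C) (i, j)
      = (\<Sum>x\<in>{..<n} \<times> {..<n}. if x = (i, j) then if {i, j} \<in> C then 1 else 0 else 0)"
    unfolding adjacency_matrix_def lookup_sum
    by (intro sum.cong refl) (auto simp: lookup_single when_def split: prod.splits)
  then show ?thesis by simp
qed

lemma adjacency_matrix_eq_sum_edges:
  assumes "finite C"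
  shows "adjacency_matrix n C = (\<Sum>e\<in>C. adjacency_matrix n {e})"
proof (rule poly_mapping_eqI)
  fix k :: "nat \<times> nat"
  obtain i j where k: "k = (i, j)" by (cases k)
  have "(\<Sum>e\<in>C. lookup (adjacency_matrix n {e}) (i, j)) = (\<Sum>e\<in>C. if e = {i, j} then if i < n \<and> j < n then 1 else 0 else 0)"
    by (intro sum.cong refl) (auto simp: lookup_adjacency_matrix)
  then show "lookup (adjacency_matrix n C) k = lookup (\<Sum>e\<in>C. adjacency_matrix n {e}) k"
    using assms by (simp add: k lookup_adjacency_matrix lookup_sum)
qed

definition indicator_vec :: "nat set \<Rightarrow> (nat \<Rightarrow>\<^sub>0 real)" where
  "indicator_vec a = (\<Sum>i\<in>a. single i 1)"

lemma lookup_indicator_vec: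
  assumes "finite a"
  shows "lookup (indicator_vec a) i = (if i \<in> a then 1 else 0)"
proof -
  have "lookup (indicator_vec a) i = (\<Sum>k\<in>a. if k = i then 1 else 0)"
    unfolding indicator_vec_def lookup_sum by (intro sum.cong refl) (simp add: lookup_single when_def)
  then show ?thesis using assms by simp
qed

lemma hamiltonian_cycle_edge:
  assumes "hamiltonian_cycle n C" "e \<in> C"
  obtains i j where "e = {i, j}" "i < n" "j < n"
proof -
  obtain xs where xs: "n \<ge> 3" "distinct xs" "set xs = {..<n}"
      "C = {{xs ! i, xs ! (Suc i mod n)} |i. i < n}"
    using assms(1) by (auto simp: hamiltonian_cycle_def)
  have len: "length xs = n" using xs distinct_card by fastforce
  obtain i where i: "i < n" "e = {xs ! i, xs ! (Suc i mod n)}" using assms(2) unfolding xs(4) by blast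
  have "Suc i mod n < n" using i by simp
  then have "xs ! i < n" "xs ! (Suc i mod n) < n"
    using nth_mem[of _ xs] i(1) unfolding xs(3) len by auto
  then show ?thesis using that i(2) by blast
qed

context clause_gadget
begin

abbreviation node_edge :: "nat \<times> nat \<Rightarrow> nat set" where
  "node_edge x \<equiv> {2 * enc x, 2 * enc x + 1}"

abbreviation arc_edge :: "nat \<times> nat \<Rightarrow> nat \<times> nat \<Rightarrow> nat set" where
  "arc_edge x y \<equiv> {2 * enc x + 1, 2 * enc y}"

abbreviation edge_matrix :: "nat set \<Rightarrow> (nat \<times> nat \<Rightarrow>\<^sub>0 real)" where
  "edge_matrix e \<equiv> adjacency_matrix vertex_count {e}"

text \<open>Each node contributes its joining edge and an affine combination of its two possible arcs, so
  that the map interpolates the adjacency matrices of the cycles at 0-1 vectors.\<close>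
definition embed :: "(nat \<Rightarrow>\<^sub>0 real) \<Rightarrow> (nat \<times> nat \<Rightarrow>\<^sub>0 real)" where
  "embed v = (\<Sum>x\<in>nodes. edge_matrix (node_edge x)
     + ((1 - lookup v (snd x)) *\<^sub>R edge_matrix (arc_edge x (succ False x))
        + lookup v (snd x) *\<^sub>R edge_matrix (arc_edge x (succ True x))))"

text \<open>An arc that is used exactly if the bit of column \<open>i\<close> is set. It leaves row 0, where the two
  bits always lead to different rows.\<close>
definition coordinate_edge :: "nat \<Rightarrow> nat \<times> nat" where
  "coordinate_edge i = (2 * enc (0, i) + 1, 2 * enc (succ True (0, i)))"

lemma enc_eq_iff: "x \<in> nodes \<Longrightarrow> y \<in> nodes \<Longrightarrow> enc x = enc y \<longleftrightarrow> x = y"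
  using enc_bij by (auto simp: bij_betw_def inj_on_def)

lemma enc_less: "x \<in> nodes \<Longrightarrow> 2 * enc x + 1 < vertex_count"
  using bij_betw_apply[OF enc_bij, of x] by (simp add: vertex_count_def)

lemma succ_in_nodes: "x \<in> nodes \<Longrightarrow> succ s x \<in> nodes"
  using succ_bij by (rule bij_betw_apply)

lemma node_edge_neq_arc_edge:
  assumes "x \<in> nodes" "y \<in> nodes" "z \<in> nodes" "y \<noteq> z"
  shows "node_edge x \<noteq> arc_edge y z"
proof
  assume "node_edge x = arc_edge y z"
  then have "enc x = enc y \<and> enc x = enc z" by (auto simp: doubleton_eq_iff)
  then show False using assms enc_eq_iff by metis
qed

lemma arc_edge_eq_iff:
  assumes "x \<in> nodes" "y \<in> nodes" "x' \<in> nodes" "y' \<in> nodes"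
  shows "arc_edge x y = arc_edge x' y' \<longleftrightarrow> x = x' \<and> y = y'"
proof
  assume "arc_edge x y = arc_edge x' y'"
  then have "enc x = enc x' \<and> enc y = enc y'" by (auto simp: doubleton_eq_iff) presburger+
  then show "x = x' \<and> y = y'" using assms enc_eq_iff by metis
qed simp

lemma affine_map_on_embed: "affine_map_on UNIV embed"
proof -
  define E where "E x = edge_matrix (arc_edge x (succ True x)) - edge_matrix (arc_edge x (succ False x))" for x
  define K where "K = (\<Sum>x\<in>nodes. edge_matrix (node_edge x) + edge_matrix (arc_edge x (succ False x)))"
  have "embed = (\<lambda>v. (\<Sum>x\<in>nodes. lookup v (snd x) *\<^sub>R E x) + K)"
    by (auto simp: embed_def K_def E_def algebra_simps simp flip: sum.distrib intro!: sum.cong)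
  moreover have "linear (\<lambda>v. \<Sum>x\<in>nodes. lookup v (snd x) *\<^sub>R E x)"
    by (simp add: linear_iff lookup_add scaleR_left_distrib sum.distrib scaleR_sum_right)
  ultimately show ?thesis
    using affine_map_on_comp[OF affine_map_on_linear affine_map_on_translation] by simp
qed

lemma embed_indicator_vec:
  assumes "a \<subseteq> {..<D}"
  shows "embed (indicator_vec a) = adjacency_matrix vertex_count (cycle_at a)"
proof -
  have fin: "finite a" using assms finite_subset by blast
  have succ: "succ_at a x \<in> nodes" "succ_at a x \<noteq> x" if "x \<in> nodes" for x
    using succ_in_nodes succ_neq_self that by (auto simp: succ_at_def)
  have inj: "inj_on node_edge nodes" "inj_on (\<lambda>x. arc_edge x (succ_at a x)) nodes"
  proof -
    show "inj_on node_edge nodes"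
    proof (rule inj_onI)
      fix x y assume "x \<in> nodes" "y \<in> nodes" "node_edge x = node_edge y"
      moreover from this(3) have "enc x = enc y" by (auto simp: doubleton_eq_iff)
      ultimately show "x = y" using enc_eq_iff by metis
    qed
    show "inj_on (\<lambda>x. arc_edge x (succ_at a x)) nodes"
    proof (rule inj_onI)
      fix x y assume "x \<in> nodes" "y \<in> nodes" "arc_edge x (succ_at a x) = arc_edge y (succ_at a y)"
      then show "x = y" using arc_edge_eq_iff[of x "succ_at a x" y "succ_at a y"] succ(1) by blast
    qed
  qed
  have "node_edges enc nodes \<inter> arc_edges enc nodes (succ_at a) = {}"
  proof (rule ccontr)
    assume "\<not> ?thesis"
    then obtain x y where "x \<in> nodes" "y \<in> nodes" "node_edge x = arc_edge y (succ_at a y)"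
      unfolding node_edges_def arc_edges_def by blast
    then show False using node_edge_neq_arc_edge[of x y "succ_at a y"] succ[of y] by metis
  qed
  then have "adjacency_matrix vertex_count (cycle_at a)
      = (\<Sum>e\<in>node_edges enc nodes. edge_matrix e) + (\<Sum>e\<in>arc_edges enc nodes (succ_at a). edge_matrix e)"
    unfolding cycle_at_def using finite_nodes
    by (subst adjacency_matrix_eq_sum_edges) (simp_all add: node_edges_def arc_edges_def sum.union_disjoint)
  also have "\<dots> = (\<Sum>x\<in>nodes. edge_matrix (node_edge x)) + (\<Sum>x\<in>nodes. edge_matrix (arc_edge x (succ_at a x)))"
    unfolding node_edges_def arc_edges_def using inj by (simp add: sum.reindex)
  also have "\<dots> = embed (indicator_vec a)"
    unfolding embed_def sum.distrib[symmetric]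
    by (intro sum.cong refl) (auto simp: lookup_indicator_vec[OF fin] succ_at_def)
  finally show ?thesis by simp
qed

lemma lookup_embed:
  assumes "i < D"
  shows "lookup (embed v) (coordinate_edge i) = lookup v i"
proof -
  let ?x = "(0, i)"
  let ?y = "succ True ?x"
  have x: "?x \<in> nodes" using assms by (simp add: nodes_def)
  have y: "?y \<in> nodes" "?y \<noteq> ?x" "?y \<noteq> succ False ?x"
    using succ_in_nodes[OF x] succ_neq_self[OF x] succ_row_0_neq[of True i] by auto
  have M: "lookup (edge_matrix e) (coordinate_edge i) = (if arc_edge ?x ?y = e then 1 else 0)" for e
    using enc_less[OF x] enc_less[OF y(1)] by (auto simp: coordinate_edge_def lookup_adjacency_matrix)
  have "lookup (embed v) (coordinate_edge i) = (\<Sum>x\<in>nodes. if x = ?x then lookup v i else 0)"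
    unfolding embed_def lookup_sum lookup_add lookup_scaleR M
  proof (intro sum.cong refl)
    fix z assume z: "z \<in> nodes"
    then have "arc_edge ?x ?y \<noteq> node_edge z" using node_edge_neq_arc_edge[of z ?x ?y] x y by metis
    moreover have "arc_edge ?x ?y = arc_edge z (succ s z) \<longleftrightarrow> z = ?x \<and> s" for s
      using arc_edge_eq_iff[OF x y(1) z succ_in_nodes[OF z, of s]] y by (cases s) auto
    ultimately show "(if arc_edge ?x ?y = node_edge z then 1 else 0) +
        ((1 - lookup v (snd z)) *\<^sub>R (if arc_edge ?x ?y = arc_edge z (succ False z) then 1 else 0) +
         lookup v (snd z) *\<^sub>R (if arc_edge ?x ?y = arc_edge z (succ True z) then 1 else 0))
      = (if z = ?x then lookup v i else 0)" by auto
  qed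
  then show ?thesis using x finite_nodes by simp
qed

definition weight :: "nat \<times> nat \<Rightarrow> real" where
  "weight = (\<lambda>(u, w). if \<exists>x\<in>nodes. u = 2 * enc x \<and> w = 2 * enc x + 1 then 1
     else if {u, w} \<notin> allowed_edges then -1 else 0)"

definition score :: "(nat \<times> nat \<Rightarrow>\<^sub>0 real) \<Rightarrow> real" where
  "score p = (\<Sum>a\<in>{..<vertex_count} \<times> {..<vertex_count}. weight a * lookup p a)"

definition max_score :: real where
  "max_score = (\<Sum>a\<in>{..<vertex_count} \<times> {..<vertex_count}. max 0 (weight a))"

text \<open>No entry of the matrix contributes more than the positive part of its weight; equality
  forces all entries of weight 1 to be present and those of weight -1 to be absent.\<close>
lemma score_adjacency_matrix:
  assumes C: "hamiltonian_cycle vertex_count C"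
  shows "score (adjacency_matrix vertex_count C) \<le> max_score"
    and "score (adjacency_matrix vertex_count C) = max_score \<longleftrightarrow>
           node_edges enc nodes \<subseteq> C \<and> C \<subseteq> allowed_edges"
proof -
  let ?A = "{..<vertex_count} \<times> {..<vertex_count}"
  let ?t = "\<lambda>a. weight a * lookup (adjacency_matrix vertex_count C) a"
  have le: "?t a \<le> max 0 (weight a)" for a
    by (cases a) (auto simp: lookup_adjacency_matrix)
  show "score (adjacency_matrix vertex_count C) \<le> max_score"
    unfolding score_def max_score_def using le by (intro sum_mono)
  have "score (adjacency_matrix vertex_count C) = max_score \<longleftrightarrow> (\<Sum>a\<in>?A. max 0 (weight a) - ?t a) = 0"
    unfolding score_def max_score_def sum_subtractf by auto
  also have "\<dots> \<longleftrightarrow> (\<forall>a\<in>?A. max 0 (weight a) = ?t a)"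
    using le by (subst sum_nonneg_eq_0_iff) auto
  also have "\<dots> \<longleftrightarrow> node_edges enc nodes \<subseteq> C \<and> C \<subseteq> allowed_edges"
  proof
    assume eq: "\<forall>a\<in>?A. max 0 (weight a) = ?t a"
    have "node_edge x \<in> C" if x: "x \<in> nodes" for x
    proof -
      have "weight (2 * enc x, 2 * enc x + 1) = 1" using x by (auto simp: weight_def)
      moreover have "(2 * enc x, 2 * enc x + 1) \<in> ?A" using enc_less[OF x] by auto
      ultimately have "lookup (adjacency_matrix vertex_count C) (2 * enc x, 2 * enc x + 1) = 1"
        using eq by (metis max_def mult_1 zero_le_one)
      then show ?thesis by (simp add: lookup_adjacency_matrix split: if_splits)
    qed
    moreover have "e \<in> allowed_edges" if e: "e \<in> C" for e
    proof (rule ccontr)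
      assume not: "e \<notin> allowed_edges"
      obtain i j where ij: "e = {i, j}" "i < vertex_count" "j < vertex_count"
        using hamiltonian_cycle_edge[OF C e] .
      have "\<not> (\<exists>x\<in>nodes. i = 2 * enc x \<and> j = 2 * enc x + 1)"
        using not ij by (auto simp: allowed_edges_def node_edges_def)
      then have "weight (i, j) = -1" using not ij by (simp add: weight_def)
      moreover have "lookup (adjacency_matrix vertex_count C) (i, j) = 1"
        using e ij by (simp add: lookup_adjacency_matrix)
      moreover have "max 0 (weight (i, j)) = ?t (i, j)" using eq ij by blast
      ultimately show False by simp
    qed
    ultimately show "node_edges enc nodes \<subseteq> C \<and> C \<subseteq> allowed_edges"
      by (auto simp: node_edges_def)
  next
    assume sub: "node_edges enc nodes \<subseteq> C \<and> C \<subseteq> allowed_edges"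
    show "\<forall>a\<in>?A. max 0 (weight a) = ?t a"
    proof
      fix a assume "a \<in> ?A"
      then obtain u w where a: "a = (u, w)" "u < vertex_count" "w < vertex_count" by auto
      have "{u, w} \<in> C" if "\<exists>x\<in>nodes. u = 2 * enc x \<and> w = 2 * enc x + 1"
        using sub that by (auto simp: node_edges_def)
      moreover have "{u, w} \<notin> C" if "{u, w} \<notin> allowed_edges" using sub that by auto
      ultimately show "max 0 (weight a) = ?t a"
        using a by (auto simp: weight_def lookup_adjacency_matrix)
    qed
  qed
  finally show "score (adjacency_matrix vertex_count C) = max_score \<longleftrightarrow>
      node_edges enc nodes \<subseteq> C \<and> C \<subseteq> allowed_edges" .
qed

definition tour_matrices :: "(nat \<times> nat \<Rightarrow>\<^sub>0 real) set" where
  "tour_matrices = {adjacency_matrix vertex_count C |C. hamiltonian_cycle vertex_count C}"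

lemma maximal_tour_matrices:
  assumes T: "\<And>r. r < L \<Longrightarrow> T r \<subseteq> {..<D}"
  shows "{p \<in> tour_matrices. score p = max_score} = embed ` indicator_vec ` {a. a \<subseteq> {..<D} \<and> a \<notin> T ` {..<L}}"
proof -
  have "{p \<in> tour_matrices. score p = max_score}
      = adjacency_matrix vertex_count ` {C. hamiltonian_cycle vertex_count C \<and> node_edges enc nodes \<subseteq> C \<and> C \<subseteq> allowed_edges}"
    using score_adjacency_matrix(2) by (auto simp: tour_matrices_def)
  also have "\<dots> = adjacency_matrix vertex_count ` cycle_at ` {a. a \<subseteq> {..<D} \<and> a \<notin> T ` {..<L}}"
  proof (intro arg_cong[where f = "image _"] set_eqI)
    fix C
    have "C \<in> cycle_at ` {a. a \<subseteq> {..<D} \<and> a \<notin> T ` {..<L}} \<longleftrightarrow> (\<exists>a. a \<subseteq> {..<D} \<and> a \<notin> T ` {..<L} \<and> C = cycle_at a)"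
      by blast
    then show "C \<in> {C. hamiltonian_cycle vertex_count C \<and> node_edges enc nodes \<subseteq> C \<and> C \<subseteq> allowed_edges} \<longleftrightarrow>
        C \<in> cycle_at ` {a. a \<subseteq> {..<D} \<and> a \<notin> T ` {..<L}}"
      using hamiltonian_cycles_between_iff[OF T, of C] by simp
  qed
  also have "\<dots> = embed ` indicator_vec ` {a. a \<subseteq> {..<D} \<and> a \<notin> T ` {..<L}}"
    unfolding image_image using embed_indicator_vec by (intro image_cong) auto
  finally show ?thesis .
qed

end

section \<open>Pyramids and the two derived bodies\<close>

lemma zero_one_polytope_eq_convex_hull:
  assumes "zero_one_polytope d P"
  obtains S where "\<And>s. s \<in> S \<Longrightarrow> s \<subseteq> {..<d}" "P = convex hull (indicator_vec ` S)"
proof -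
  obtain V where V: "finite V" "P = convex hull V" using assms by (auto simp: zero_one_polytope_def polytope_def)
  have P: "P = convex hull (vertices P)"
    using convex_hull_eq_hull_of_extreme_points[OF V(1)] unfolding V(2) .
  let ?S = "{s. s \<subseteq> {..<d} \<and> indicator_vec s \<in> vertices P}"
  have "vertices P \<subseteq> indicator_vec ` ?S"
  proof
    fix v assume v: "v \<in> vertices P"
    define s where "s = {i. i < d \<and> lookup v i = 1}"
    have "v \<in> P" using v by (simp add: vertices_def extreme_point_of_def)
    then have keys: "keys v \<subseteq> {..<d}" using assms by (auto simp: zero_one_polytope_def)
    have vals: "lookup v i = 0 \<or> lookup v i = 1" if "i < d" for i
      using assms v that by (auto simp: zero_one_polytope_def)
    have "v = indicator_vec s"
    proof (rule poly_mapping_eqI)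
      fix i
      have fin: "finite s" by (simp add: s_def)
      show "lookup v i = lookup (indicator_vec s) i"
        unfolding lookup_indicator_vec[OF fin]
        using vals[of i] keys by (cases "i < d") (auto simp: s_def in_keys_iff)
    qed
    then show "v \<in> indicator_vec ` ?S" using v by (auto simp: s_def)
  qed
  then have "vertices P = indicator_vec ` ?S" by blast
  then show ?thesis using P by (intro that[of ?S]) auto
qed

lemma finite_set_as_padded_sequence:
  assumes "finite A" "A \<noteq> {}" "card A \<le> l"
  obtains T :: "nat \<Rightarrow> 'a" where "T ` {..<l} = A"
proof -
  obtain h where h: "bij_betw h {0..<card A} A" using ex_bij_betw_nat_finite[OF assms(1)] by blast
  have pos: "card A > 0" using assms by (simp add: card_gt_0_iff)
  let ?T = "\<lambda>r. h (if r < card A then r else 0)"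
  have "?T ` {..<l} \<subseteq> A" using h pos by (auto simp: bij_betw_def)
  moreover have "A \<subseteq> ?T ` {..<l}"
  proof
    fix x assume "x \<in> A"
    then have "x \<in> h ` {0..<card A}" using h by (simp add: bij_betw_def)
    then obtain r where "r < card A" "x = h r" by auto
    then show "x \<in> ?T ` {..<l}" using assms(3) by (intro image_eqI[of _ _ r]) auto
  qed
  ultimately show ?thesis using that[of ?T] by blast
qed

text \<open>The points with \<open>f x = b\<close> and \<open>h x = 1\<close> are those where \<open>f + h\<close> is maximal, and the points with
  \<open>f x = b\<close> and \<open>h x = 0\<close> are those where \<open>f - h\<close> is maximal.\<close>
lemma pyramid_levels:
  fixes f h :: "'a::real_vector \<Rightarrow> real"
  assumes f: "linear f" and h: "linear h"
    and le: "\<And>x. x \<in> X \<Longrightarrow> f x \<le> b" "\<And>x. x \<in> X \<Longrightarrow> 0 \<le> h x" "\<And>x. x \<in> X \<Longrightarrow> h x \<le> 1"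
  shows "\<And>x. x \<in> convex hull X \<Longrightarrow> f x \<le> b \<and> 0 \<le> h x \<and> h x \<le> 1"
    and "{x \<in> convex hull X. f x = b \<and> h x = 1} = convex hull {x \<in> X. f x = b \<and> h x = 1}"
    and "{x \<in> convex hull X. f x = b \<and> h x = 0} = convex hull {x \<in> X. f x = b \<and> h x = 0}"
proof -
  have lin: "linear (\<lambda>x. - h x)" "linear (\<lambda>x. f x + h x)" "linear (\<lambda>x. f x - h x)"
    using f h by (auto simp: linear_iff algebra_simps)
  show hull: "f x \<le> b \<and> 0 \<le> h x \<and> h x \<le> 1" if "x \<in> convex hull X" for x
    using maximal_level_of_convex_hull(2)[OF f le(1) that] maximal_level_of_convex_hull(2)[OF h le(3) that]
      maximal_level_of_convex_hull(2)[OF lin(1) _ that, of 0] le(2) by auto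
  have top: "f x + h x = b + 1 \<longleftrightarrow> f x = b \<and> h x = 1" "f x - h x = b \<longleftrightarrow> f x = b \<and> h x = 0"
    if "x \<in> convex hull X" for x
    using hull[OF that] by auto
  have X: "x \<in> convex hull X" if "x \<in> X" for x using that by (rule hull_inc)
  have "{x \<in> convex hull X. f x + h x = b + 1} = convex hull {x \<in> X. f x + h x = b + 1}"
    using le by (intro maximal_level_of_convex_hull(1) lin) (smt (verit))
  moreover have "{x \<in> convex hull X. f x + h x = b + 1} = {x \<in> convex hull X. f x = b \<and> h x = 1}"
    using top by blast
  moreover have "{x \<in> X. f x + h x = b + 1} = {x \<in> X. f x = b \<and> h x = 1}"
    using top X by blast
  ultimately show "{x \<in> convex hull X. f x = b \<and> h x = 1} = convex hull {x \<in> X. f x = b \<and> h x = 1}"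
    by simp
  have "{x \<in> convex hull X. f x - h x = b} = convex hull {x \<in> X. f x - h x = b}"
    using le by (intro maximal_level_of_convex_hull(1) lin) (smt (verit))
  moreover have "{x \<in> convex hull X. f x - h x = b} = {x \<in> convex hull X. f x = b \<and> h x = 0}"
    using top by blast
  moreover have "{x \<in> X. f x - h x = b} = {x \<in> X. f x = b \<and> h x = 0}"
    using top X by blast
  ultimately show "{x \<in> convex hull X. f x = b \<and> h x = 0} = convex hull {x \<in> X. f x = b \<and> h x = 0}"
    by simp
qed

text \<open>Coordinate \<open>d\<close> is the height of the pyramid over \<open>P\<close>, with the origin as its apex. Coordinate
  \<open>d + 1\<close> is zero throughout; it ensures that there is a set to exclude. For all \<open>P\<close> the excluded
  sets fit into one sequence of length \<open>L\<close>, and this makes the number of vertices uniform.\<close>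
lemma face_of_TSP2_and_RTSP:
  assumes gadget: "clause_gadget D L" and d: "Suc d < D" and L: "card (Pow {..<D}) \<le> L"
    and m: "m \<ge> 2" and P: "zero_one_polytope d P"
  shows "(\<exists>F. F face_of TSP2 (clause_gadget.vertex_count D L) \<and> affinely_isomorphic P F) \<and>
         (\<exists>F. F face_of RTSP m (clause_gadget.vertex_count D L) \<and> affinely_isomorphic P F)"
proof -
  obtain S where S: "\<And>s. s \<in> S \<Longrightarrow> s \<subseteq> {..<d}" "P = convex hull (indicator_vec ` S)"
    using zero_one_polytope_eq_convex_hull[OF P] by blast
  define good where "good = insert {} (insert d ` S)"
  have good: "good \<subseteq> Pow {..<D}" using S(1) d by (fastforce simp: good_def)
  obtain T where T: "T ` {..<L} = Pow {..<D} - good"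
  proof (rule finite_set_as_padded_sequence[of "Pow {..<D} - good" L])
    have "{Suc d} \<in> Pow {..<D} - good" using S(1) d by (auto simp: good_def)
    then show "Pow {..<D} - good \<noteq> {}" by blast
    show "card (Pow {..<D} - good) \<le> L" using L by (meson card_mono Diff_subset finite_Pow_iff finite_lessThan order_trans)
  qed auto
  interpret clause_gadget "D" L T by (rule gadget)
  have selected: "{a. a \<subseteq> {..<D} \<and> a \<notin> T ` {..<L}} = good"
    unfolding T using good by blast
  have T': "T r \<subseteq> {..<D}" if "r < L" for r using T that by blast

  let ?e = "coordinate_edge d"
  let ?c = "(1 / real (card (vertices (stsp_polytope vertex_count)))) *\<^sub>R (\<Sum>v\<in>vertices (stsp_polytope vertex_count). v)"
  define c where "c = ?c"
  define K where "K = STSP vertex_count"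
  have stsp: "stsp_polytope vertex_count = convex hull tour_matrices"
    by (simp add: stsp_polytope_def tour_matrices_def)
  have K: "K = (\<lambda>x. x - c) ` (convex hull tour_matrices)"
    by (simp only: K_def STSP_def Let_def c_def stsp)
  have translate: "affine_map_on UNIV (\<lambda>x. x - c)"
    using affine_map_on_translation[of "- c"] by simp
  have convK: "convex K"
    unfolding K affine_map_image_convex_hull[OF translate] by (rule convex_convex_hull)
  have lin: "linear score" "linear (\<lambda>p. lookup p ?e)"
    by (auto simp: score_def linear_iff lookup_add algebra_simps sum.distrib sum_distrib_left)
  have X: "score x \<le> max_score" "0 \<le> lookup x ?e" "lookup x ?e \<le> 1" if "x \<in> tour_matrices" for x
  proof -
    obtain C where C: "hamiltonian_cycle vertex_count C" "x = adjacency_matrix vertex_count C"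
      using \<open>x \<in> tour_matrices\<close> by (auto simp: tour_matrices_def)
    show "score x \<le> max_score" unfolding C(2) using C(1) by (rule score_adjacency_matrix(1))
    show "0 \<le> lookup x ?e" "lookup x ?e \<le> 1"
      unfolding C(2) by (cases ?e; simp add: lookup_adjacency_matrix)+
  qed
  have bounds: "score x \<le> max_score \<and> 0 \<le> lookup x ?e \<and> lookup x ?e \<le> 1"
    if "x \<in> convex hull tour_matrices" for x
    using that by (rule pyramid_levels(1)[OF lin X, rotated -1])
  have levels: "{x \<in> convex hull tour_matrices. score x = max_score \<and> lookup x ?e = 1}
        = convex hull {x \<in> tour_matrices. score x = max_score \<and> lookup x ?e = 1}"
      "{x \<in> convex hull tour_matrices. score x = max_score \<and> lookup x ?e = 0}
        = convex hull {x \<in> tour_matrices. score x = max_score \<and> lookup x ?e = 0}"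
    using pyramid_levels(2,3)[OF lin X] by blast+

  have coord: "lookup (embed (indicator_vec a)) ?e = (if d \<in> a then 1 else 0)" if "a \<in> good" for a
  proof -
    have "finite a" using that good by (meson PowD finite_lessThan finite_subset subsetD)
    then show ?thesis using d by (simp add: lookup_embed lookup_indicator_vec)
  qed
  have maximal: "{x \<in> tour_matrices. score x = max_score \<and> lookup x ?e = t}
      = {x \<in> embed ` indicator_vec ` good. lookup x ?e = t}" for t
    using maximal_tour_matrices[OF T'] unfolding selected by blast
  have apex: "{x \<in> tour_matrices. score x = max_score \<and> lookup x ?e = 0} = {embed (indicator_vec {})}"
    unfolding maximal using coord by (auto simp: good_def)
  have base: "{x \<in> tour_matrices. score x = max_score \<and> lookup x ?e = 1} = embed ` indicator_vec ` insert d ` S"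
    unfolding maximal using coord by (auto simp: good_def split: if_splits)

  \<comment> \<open>\<open>P\<close> is raised to height 1, embedded, and moved along with the centre of the polytope.\<close>
  define lift where "lift v = embed (v + single d 1) - c" for v
  have lift_affine: "affine_map_on UNIV lift"
    unfolding lift_def
    by (intro affine_map_on_comp[OF _ translate] affine_map_on_comp[OF _ affine_map_on_embed] affine_map_on_translation)
  have "indicator_vec (insert d s) = indicator_vec s + single d 1" if "s \<in> S" for s
  proof -
    have "finite s" "d \<notin> s" using S(1)[OF that] finite_subset by auto
    then show ?thesis by (simp add: indicator_vec_def)
  qed
  then have base_lift: "(\<lambda>x. x - c) ` embed ` indicator_vec ` insert d ` S = lift ` indicator_vec ` S"
    unfolding image_image lift_def by (intro image_cong) auto

  define w where "w = embed (indicator_vec {}) - c"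
  have shift: "{p \<in> K. score p = max_score - score c \<and> lookup p ?e + lookup c ?e = t}
      = (\<lambda>x. x - c) ` {x \<in> convex hull tour_matrices. score x = max_score \<and> lookup x ?e = t}" for t
    unfolding K using linear_diff[OF lin(1)] by (auto simp: lookup_minus)
  have apexK: "{p \<in> K. score p = max_score - score c \<and> lookup p ?e + lookup c ?e = 0} = {w}"
    unfolding shift levels(2) apex by (simp add: w_def)
  have baseK: "{p \<in> K. score p = max_score - score c \<and> lookup p ?e + lookup c ?e = 1} = lift ` P"
    unfolding shift levels(1) base affine_map_image_convex_hull[OF translate] base_lift S(2)
      affine_map_image_convex_hull[OF lift_affine] ..
  have boundsK: "score p \<le> max_score - score c" "0 \<le> lookup p ?e + lookup c ?e" "lookup p ?e + lookup c ?e \<le> 1"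
    if "p \<in> K" for p
  proof -
    obtain x where x: "x \<in> convex hull tour_matrices" "p = x - c" using \<open>p \<in> K\<close> K by blast
    show "score p \<le> max_score - score c" "0 \<le> lookup p ?e + lookup c ?e" "lookup p ?e + lookup c ?e \<le> 1"
      using bounds[OF x(1)] linear_diff[OF lin(1)] by (simp_all add: x(2) lookup_minus)
  qed

  \<comment> \<open>The copy of \<open>d\<close>-dimensional space that contains \<open>P\<close>.\<close>
  define A :: "(nat \<Rightarrow>\<^sub>0 real) set" where "A = {v. \<forall>i\<ge>d. lookup v i = 0}"
  have "affine A" by (auto simp: A_def affine_def lookup_add)
  have PA: "P \<subseteq> A" using P by (fastforce simp: A_def zero_one_polytope_def in_keys_iff)
  have inj_lift: "inj_on lift A"
  proof (rule inj_onI, rule poly_mapping_eqI)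
    fix u v i assume uv: "u \<in> A" "v \<in> A" "lift u = lift v"
    show "lookup u i = lookup v i"
    proof (cases "i < d")
      case True
      have "lookup (embed (u + single d 1)) (coordinate_edge i) = lookup (embed (v + single d 1)) (coordinate_edge i)"
        using uv(3) by (simp add: lift_def)
      then show ?thesis using True d by (simp add: lookup_embed lookup_add)
    qed (use uv in \<open>simp add: A_def\<close>)
  qed
  have iso: "affinely_isomorphic P (g ` lift ` P)" if "affine_map_on UNIV g" "inj g" for g :: "_ \<Rightarrow> 'z::real_vector"
  proof -
    have "inj_on (\<lambda>x. g (lift x)) A" using inj_lift that(2) by (simp add: inj_on_def)
    then show ?thesis
      using affinely_isomorphic_image[OF affine_map_on_comp[OF lift_affine that(1)] \<open>affine A\<close> PA]
      by (simp add: image_image)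
  qed

  have "(\<lambda>p. (p, w, tensor_vec p w)) ` lift ` P face_of TSP2 vertex_count"
  proof -
    have "{p \<in> K. score p - lookup p ?e = max_score - score c + lookup c ?e} = {w}"
      unfolding apexK[symmetric] using boundsK by (intro Collect_cong) (smt (verit))
    moreover have "score p + lookup p ?e \<le> max_score - score c + (1 - lookup c ?e)"
        "score p - lookup p ?e \<le> max_score - score c + lookup c ?e" if "p \<in> K" for p
      using boundsK[OF that] by linarith+
    ultimately have "(\<lambda>p. (p, w, tensor_vec p w)) ` {p \<in> K. score p + lookup p ?e = max_score - score c + (1 - lookup c ?e)}
        face_of tensor_body K K"
      by (intro tensor_body_face[where g = "\<lambda>p. score p - lookup p ?e" and c = "max_score - score c + lookup c ?e"]
          linear_compose_add linear_compose_sub lin convK)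
    moreover have "{p \<in> K. score p + lookup p ?e = max_score - score c + (1 - lookup c ?e)} = lift ` P"
      unfolding baseK[symmetric] using boundsK by (intro Collect_cong) (smt (verit))
    ultimately show ?thesis by (simp only: TSP2_def K_def)
  qed
  moreover have "affinely_isomorphic P ((\<lambda>p. (p, w, tensor_vec p w)) ` lift ` P)"
    by (intro iso affine_map_on_tensor) (simp add: inj_on_def)
  moreover have "pencil m w ` lift ` P face_of RTSP m vertex_count"
    unfolding RTSP_def K_def[symmetric] baseK[symmetric]
    by (rule sym_body_face[OF m convK _ score_def boundsK apexK]) auto
  moreover have "affinely_isomorphic P (pencil m w ` lift ` P)"
    using m by (intro iso affine_map_on_pencil inj_pencil) auto
  ultimately show ?thesis by blast
qed

theorem theorem3p7:
  fixes m :: nat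
  assumes "m > 1"
  shows "\<forall>d. \<exists>n>0. \<forall>P. zero_one_polytope d P \<longrightarrow>
           (\<exists>F. F face_of TSP2 n \<and> affinely_isomorphic P F) \<and>
           (\<exists>F. F face_of RTSP m n \<and> affinely_isomorphic P F)"
proof
  fix d :: nat
  let ?L = "card (Pow {..<d + 2})"
  have gadget: "clause_gadget (d + 2) ?L" by unfold_locales (simp_all add: card_Pow)
  have "clause_gadget.vertex_count (d + 2) ?L > 0"
    unfolding clause_gadget.vertex_count_def[OF gadget] by simp
  moreover have "(\<exists>F. F face_of TSP2 (clause_gadget.vertex_count (d + 2) ?L) \<and> affinely_isomorphic P F) \<and>
      (\<exists>F. F face_of RTSP m (clause_gadget.vertex_count (d + 2) ?L) \<and> affinely_isomorphic P F)"
    if "zero_one_polytope d P" for P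
    using assms that by (intro face_of_TSP2_and_RTSP[OF gadget _ order_refl]) auto
  ultimately show "\<exists>n>0. \<forall>P. zero_one_polytope d P \<longrightarrow>
           (\<exists>F. F face_of TSP2 n \<and> affinely_isomorphic P F) \<and>
           (\<exists>F. F face_of RTSP m n \<and> affinely_isomorphic P F)"
    by blast
qed

end
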